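(* Let $(b_N)$ be a sequence of positive integers with $b_N\to\infty$ and $b_N=o(N)$. For each $N$ let $\sim$ be an equivalence relation on $\{1,\dots,N\}^2$ with $(p,q)\sim(q,p)$ for all $p,q$, satisfying, as $N\to\infty$, (O1) $\max_p\#\{(q,r,s)\in\{1,\dots,N\}^3:(p,q)\sim(r,s)\}=o(b_N^2)$; (O2) $\max_{p,q,r}\#\{s\in\{1,\dots,N\}:(p,q)\sim(r,s)\}\le B<\infty$ with $B$ independent of $N$; (O3) $\#\{(p,q,r)\in\{1,\dots,N\}^3:(p,q)\sim(q,r),\ r\neq p\}=o(b_N^2)$. Let $(X^{(N)}_{ij})_{1\le i,j\le N}$ be real random variables with $X^{(N)}_{ij}=X^{(N)}_{ji}$, $\mathbb EX^{(N)}_{ij}=0$, $\mathbb E(X^{(N)}_{ij})^2=1$, $\sup_N\max_{i,j}\mathbb E|X^{(N)}_{ij}|^k<\infty$ for all $k$, and such that for each $N$ the families $\{X^{(N)}_{pq}:(p,q)\in C\}$, $C$ ranging over the distinct $\sim$-classes, are mutually independent. Let $$A^{(N)}:=\frac{1}{\sqrt{2b_N}}\Big(\chi_{[0,b_N]}(|i-j|)\,X^{(N)}_{ij}\Big)_{1\le i,j\le N}.$$ Then for all $k\in\mathbb N$, $$\lim_{N\to\infty}\frac1N\mathbb E\big(\operatorname{tr}(A^{(N)})^k\big)=\begin{cases}C_{k/2}&k\text{ even},\\0&k\text{ odd},\end{cases}\qquad C_n=\frac{1}{n+1}\binom{2n}{n}.$$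
   Context: $\chi_{[0,b_N]}(|i-j|)$ equals $1$ if $|i-j|\le b_N$ and $0$ otherwise. *)

theory Defs
  imports "HOL-Probability.Probability" "HOL-Library.Landau_Symbols"
begin

text \<open>Square matrices of size N are represented as functions nat => nat => real,
  indexed by 1..N (entries outside are irrelevant).\<close>

definition sqmat_mult :: "nat \<Rightarrow> (nat \<Rightarrow> nat \<Rightarrow> real) \<Rightarrow> (nat \<Rightarrow> nat \<Rightarrow> real) \<Rightarrow> (nat \<Rightarrow> nat \<Rightarrow> real)" where
  "sqmat_mult N A B = (\<lambda>i j. \<Sum>l\<in>{1..N}. A i l * B l j)"

fun sqmat_pow :: "nat \<Rightarrow> (nat \<Rightarrow> nat \<Rightarrow> real) \<Rightarrow> nat \<Rightarrow> (nat \<Rightarrow> nat \<Rightarrow> real)" where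
  "sqmat_pow N A 0 = (\<lambda>i j. if i = j then 1 else 0)"
| "sqmat_pow N A (Suc k) = sqmat_mult N (sqmat_pow N A k) A"

definition sqmat_trace :: "nat \<Rightarrow> (nat \<Rightarrow> nat \<Rightarrow> real) \<Rightarrow> real" where
  "sqmat_trace N A = (\<Sum>i\<in>{1..N}. A i i)"

definition catalan :: "nat \<Rightarrow> real" where
  "catalan n = real ((2 * n) choose n) / real (n + 1)"

definition band_matrix :: "nat \<Rightarrow> (nat \<Rightarrow> nat \<Rightarrow> real) \<Rightarrow> (nat \<Rightarrow> nat \<Rightarrow> real)" where
  "band_matrix bN Y = (\<lambda>i j. (if \<bar>int i - int j\<bar> \<le> int bN then Y i j else 0) / sqrt (2 * real bN))"

end

theory Submission
  imports Defs "HOL-Real_Asymp.Real_Asymp"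
begin

text \<open>
  Expand the trace over closed walks \<open>p\<^sub>0, \<dots>, p\<^sub>k\<close> in the band and label each edge by its
  \<open>\<sim>\<close>-class. By independence a walk in which some class occurs exactly once contributes \<open>0\<close>. By (O2) the
  walks realising a given label word with \<open>m\<close> distinct letters number \<open>O(N b\<^sup>m)\<close>, so if no letter is
  isolated only the words in which every letter occurs exactly twice survive.

  Such a word contains two occurrences of a letter \<open>a\<close> with distinct letters in between. If there is
  something in between, (O1) fixes both ends of that stretch of the walk, and a factor \<open>b\<close> is lost.
  Otherwise \<open>a a\<close> is a factor of the word; by (O3) the walk backtracks along this edge up to a
  negligible set, and the backtracking can be cut out. Hence, up to \<open>o(N b\<^bsup>k/2\<^esup>)\<close> walks, a contributing
  walk reflects a Dyck word: pushing and popping edges on a stack empties the stack. Such walks have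
  expectation \<open>1\<close>, each Dyck word is reflected by about \<open>N (2b)\<^bsup>k/2\<^esup>\<close> walks, and Dyck words are
  counted by the Catalan numbers. Closedness of the walk is never needed for the upper bounds, so all
  walks are treated as open ones.
\<close>

section \<open>Dyck words and stack parsing\<close>

text \<open>Two identifications of edges are in play. Labels identify
  \<open>\<sim>\<close>-equivalent edges, which is what independence sees; the stack identifies an
  edge only with its reversal, which makes every pop forced and the walks countable. Passing from
  the first to the second is the hard point: for a word in which every letter occurs twice, the
  bound from (O2) has the same order \<open>N * b^(k/2)\<close> as the main term, so a gain is
  needed. Relative to that bound, a nonempty stretch gains \<open>D1 / (2b+1)^2\<close> from (O1)
  and a failed backtracking gains \<open>D3 / (N (2b+1))\<close> from (O3). Estimates are made for
  fixed \<open>N\<close>, with constants depending only on \<open>k\<close>, \<open>B\<close> and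
  the moments. Off two small sets of walks the expectation equals the number of Dyck words reflected
  by the walk, so exchanging sums turns the trace into a sum over Dyck words. Odd \<open>k\<close>
  needs no separate argument, as no Dyck word has odd length. Band neighbourhoods have up to
  \<open>2b+1\<close> points while the matrix is normalised by \<open>2b\<close>; the ratio is
  carried along as a factor tending to 1.\<close>

fun dyck :: "nat \<Rightarrow> bool list \<Rightarrow> bool" where
  "dyck h [] \<longleftrightarrow> h = 0"
| "dyck h (True # d) \<longleftrightarrow> dyck (Suc h) d"
| "dyck h (False # d) \<longleftrightarrow> h > 0 \<and> dyck (h - 1) d"

lemma dyck_length: "dyck h d \<Longrightarrow> length d + h = 2 * count_list d True + 2 * h"
  by (induction h d rule: dyck.induct) auto

definition dyck_words :: "nat \<Rightarrow> nat \<Rightarrow> bool list set" where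
  "dyck_words n h = {d. length d = n \<and> dyck h d}"

lemma finite_dyck_words [simp]: "finite (dyck_words n h)"
  by (rule finite_subset[OF _ finite_lists_length_eq[of UNIV n]]) (auto simp: dyck_words_def)

lemma card_dyck_words_Suc:
  "card (dyck_words (Suc n) h)
     = card (dyck_words n (Suc h)) + (if h = 0 then 0 else card (dyck_words n (h - 1)))"
proof -
  have eq: "dyck_words (Suc n) h = (#) True ` dyck_words n (Suc h)
          \<union> (if h = 0 then {} else (#) False ` dyck_words n (h - 1))" (is "?L = ?R")
  proof (intro set_eqI iffI)
    fix d assume "d \<in> ?L"
    then obtain c d' where "d = c # d'" "length d' = n" "dyck h (c # d')"
      by (auto simp: dyck_words_def length_Suc_conv)
    then show "d \<in> ?R"
      by (cases c) (auto simp: dyck_words_def)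
  qed (auto simp: dyck_words_def split: if_splits)
  have "(#) True ` dyck_words n (Suc h) \<inter> (#) False ` dyck_words n (h - 1) = {}"
    by auto
  then show ?thesis
    unfolding eq by (auto simp: card_Un_disjoint card_image)
qed

text \<open>The closed form of the ballot numbers, from the reflection principle; the index
  \<open>j = (n + h) / 2\<close> keeps the second binomial free of truncated subtraction.\<close>

lemma card_dyck_words:
  "n + h = 2 * j \<Longrightarrow> int (card (dyck_words n h)) = int (n choose j) - int (n choose Suc j)"
proof (induction n arbitrary: h j)
  case 0
  have "dyck_words 0 h = (if h = 0 then {[]} else {})"
    by (auto simp: dyck_words_def)
  with 0 show ?case
    by (cases j) auto
next
  case (Suc n)
  show ?case
  proof (cases h)
    case 0
    with Suc.prems obtain i where i: "j = Suc i" "n = Suc (2 * i)"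
      by (cases j) auto
    have "int (card (dyck_words n (Suc 0))) = int (n choose j) - int (n choose Suc j)"
      using Suc.IH[of "Suc 0" j] Suc.prems 0 by simp
    \<comment> \<open>At height 0 no down step is available, and Pascal's rule leaves
      \<open>n choose i\<close> where the recursion yields \<open>n choose j\<close>; the two agree
      because \<open>i + j = n\<close>.\<close>
    moreover have "n choose i = n choose j"
      using binomial_symmetric[of j n] i by simp
    ultimately show ?thesis
      using 0 i by (simp add: card_dyck_words_Suc)
  next
    case (Suc h')
    with Suc.prems obtain i where i: "j = Suc i"
      by (cases j) auto
    have "int (card (dyck_words n (Suc h))) = int (n choose j) - int (n choose Suc j)"
      using Suc.IH[of "Suc h" j] Suc.prems by simp
    moreover have "int (card (dyck_words n h')) = int (n choose i) - int (n choose Suc i)"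
      using Suc.IH[of h' i] Suc.prems Suc i by simp
    ultimately show ?thesis
      using Suc i by (simp add: card_dyck_words_Suc)
  qed
qed

lemma card_dyck_words_catalan: "real (card (dyck_words (2 * n) 0)) = catalan n"
proof -
  have "int (card (dyck_words (2 * n) 0)) = int (2 * n choose n) - int (2 * n choose Suc n)"
    by (rule card_dyck_words) simp
  then have 1: "real (card (dyck_words (2 * n) 0)) = real (2 * n choose n) - real (2 * n choose Suc n)"
    by linarith
  have "Suc n * (2 * n choose Suc n) = n * (2 * n choose n)"
    using binomial_absorb_comp[of "2 * n" n] binomial_absorption[of n "2 * n"]
    by (metis add_diff_cancel_left' mult_2)
  then have "real (Suc n) * real (2 * n choose Suc n) = real n * real (2 * n choose n)"
    by (metis of_nat_mult)
  then show ?thesis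
    unfolding 1 catalan_def by (simp add: field_simps)
qed

lemma dyck_words_odd: "odd n \<Longrightarrow> dyck_words n 0 = {}"
  using dyck_length[of 0] by (auto simp: dyck_words_def)

text \<open>\<open>d\<close> lists the stack instructions carried out while reading
  \<open>w\<close>: \<open>True\<close> pushes the letter read, \<open>False\<close> requires it on
  top and pops it. The letter type is arbitrary because the same parse is run on undirected edges
  and on \<open>\<sim>\<close>-classes.\<close>

fun parse :: "'l list \<Rightarrow> bool list \<Rightarrow> 'l list \<Rightarrow> bool" where
  "parse s [] [] \<longleftrightarrow> s = []"
| "parse s (True # d) (a # w) \<longleftrightarrow> parse (a # s) d w"
| "parse (t # s) (False # d) (a # w) \<longleftrightarrow> a = t \<and> parse s d w"
| "parse _ _ _ \<longleftrightarrow> False"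

lemma parse_imp_dyck: "parse s d w \<Longrightarrow> dyck (length s) d \<and> length d = length w"
  by (induction s d w rule: parse.induct) auto

lemma parse_map: "parse s d w \<Longrightarrow> parse (map f s) d (map f w)"
  by (induction s d w rule: parse.induct) auto

text \<open>Pushes and pops of \<open>a\<close> pair off, and each copy of \<open>a\<close>
  initially on the stack accounts for one further pop.\<close>

lemma parse_even_count: "parse s d w \<Longrightarrow> even (count_list w a + count_list s a)"
  by (induction s d w rule: parse.induct) auto

text \<open>After \<open>length u\<close> instructions the new letter is pushed and popped at once,
  which restores the stack. This is the inverse of cutting out a backtrack.\<close>

lemma parse_insert_pair:
  "parse s d (u @ v) \<Longrightarrow>
     parse s (take (length u) d @ True # False # drop (length u) d) (u @ a # a # v)"
proof (induction u arbitrary: s d)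
  case (Cons c u)
  then show ?case
    by (cases d; cases "hd d"; cases s) auto
qed simp

lemma parse_count_le: "parse s d w \<Longrightarrow> count_list s a \<le> count_list w a"
  by (induction s d w rule: parse.induct) (auto split: if_splits)

text \<open>With at most two copies of \<open>a\<close> in sight the instruction is forced: pushing
  \<open>a\<close> above another copy would require two later copies to pop both, and popping needs
  a copy on the stack.\<close>

lemma parse_push_iff:
  assumes "parse s (c # d) (a # w)" and "count_list (a # w) a + count_list s a \<le> 2"
  shows "c \<longleftrightarrow> a \<notin> set s"
proof (cases c)
  case True
  then have "count_list s a < count_list w a"
    using assms(1) parse_count_le[of "a # s" d w a] by simp
  with assms(2) have "count_list s a = 0"
    by simp
  with True show ?thesis
    by (simp add: count_list_0_iff)
next
  case False
  with assms(1) show ?thesis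
    by (cases s) auto
qed

text \<open>The bound on the copies of a letter in the remaining word and the stack together is
  preserved by both instructions, so \<open>parse_push_iff\<close> determines \<open>d\<close>
  letter by letter.\<close>

lemma parse_unique:
  assumes "parse s d w" "parse s d' w" "\<And>a. count_list w a + count_list s a \<le> 2"
  shows "d = d'"
  using assms
proof (induction w arbitrary: s d d')
  case Nil
  then show ?case
    by (cases d; cases d') (use parse_imp_dyck in fastforce)+
next
  case (Cons a w)
  obtain c e c' e' where d: "d = c # e" "d' = c' # e'"
    using Cons.prems(1,2) parse_imp_dyck by (metis length_Suc_conv length_Cons)
  have c: "c = c'"
    using parse_push_iff Cons.prems d by metis
  show ?case
  proof (cases c)
    case True
    have "count_list w b + count_list (a # s) b \<le> 2" for b
      using Cons.prems(3)[of b] by (auto split: if_splits)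
    then have "e = e'"
      using Cons.prems(1,2) c d True by (intro Cons.IH[of "a # s"]) auto
    then show ?thesis using c d by simp
  next
    case False
    then obtain t where t: "s = a # t" "parse t e w" "parse t e' w"
      using Cons.prems c d by (cases s) auto
    have "count_list w b + count_list t b \<le> 2" for b
      using Cons.prems(3)[of b] t by (auto split: if_splits)
    then show ?thesis
      using Cons.IH[OF t(2,3)] c d by simp
  qed
qed

section \<open>Walks in the band\<close>

fun edges :: "'v list \<Rightarrow> ('v \<times> 'v) list" where
  "edges (x # y # p) = (x, y) # edges (y # p)"
| "edges _ = []"

lemma length_edges [simp]: "length (edges p) = length p - 1"
  by (induction p rule: edges.induct) auto

lemma edges_append: "edges (p @ x # q) = edges (p @ [x]) @ edges (x # q)"
  by (induction p rule: edges.induct) auto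

lemma edges_rev: "edges (rev p) = rev (map prod.swap (edges p))"
proof (induction p rule: edges.induct)
  case (1 x y p)
  have "edges (rev (x # y # p)) = edges (rev p @ [y]) @ edges [y, x]"
    using edges_append[of "rev p" y "[x]"] by simp
  with 1 show ?case
    by simp
qed auto

lemma set_edges_subset: "set (edges p) \<subseteq> set p \<times> set p"
  by (induction p rule: edges.induct) auto

definition undirected :: "'v \<times> 'v \<Rightarrow> 'v set" where
  "undirected e = {fst e, snd e}"

lemma undirected_eq_iff: "undirected e = undirected e' \<longleftrightarrow> e' = e \<or> e' = prod.swap e"
  by (cases e; cases e') (auto simp: undirected_def doubleton_eq_iff)

lemma undirected_commute: "undirected (x, y) = undirected (y, x)"
  by (auto simp: undirected_def)

definition near :: "nat \<Rightarrow> nat \<times> nat \<Rightarrow> bool" where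
  "near b e \<longleftrightarrow> \<bar>int (fst e) - int (snd e)\<bar> \<le> int b"

lemma near_swap [simp]: "near b (prod.swap e) = near b e"
  by (auto simp: near_def)

lemma near_set_eq: "{x. near b (v, x)} = {v - b..v + b}"
  by (auto simp: near_def)

lemma finite_near [simp]: "finite {x. near b (v, x)}"
  by (simp add: near_set_eq)

text \<open>For \<open>v < b\<close> truncated subtraction cuts the interval off at 0; for
  \<open>b \<le> v\<close> equality holds.\<close>

lemma card_near_le: "card {x. near b (v, x)} \<le> 2 * b + 1"
  by (simp add: near_set_eq)

definition walks :: "nat \<Rightarrow> nat \<Rightarrow> nat \<Rightarrow> nat list set" where
  "walks N b k = {p. length p = Suc k \<and> set p \<subseteq> {1..N} \<and> (\<forall>e\<in>set (edges p). near b e)}"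

lemma finite_walks [simp]: "finite (walks N b k)"
  by (rule finite_subset[OF _ finite_lists_length_eq[of "{1..N}" "Suc k"]]) (auto simp: walks_def)

lemma walks_Suc_iff:
  "x # p \<in> walks N b (Suc k) \<longleftrightarrow> x \<in> {1..N} \<and> near b (x, hd p) \<and> p \<in> walks N b k"
  by (cases p) (auto simp: walks_def)

lemma rev_walks_iff [simp]: "rev p \<in> walks N b k \<longleftrightarrow> p \<in> walks N b k"
  by (auto simp: walks_def edges_rev)

lemma take_in_walks:
  assumes "p \<in> walks N b k" "j \<le> k"
  shows "take (Suc j) p \<in> walks N b j"
proof -
  have "\<exists>q. edges p = edges (take (Suc j) p) @ q"
    using assms edges_append[of "take j p" "p ! j" "drop (Suc j) p"]
    by (simp add: walks_def id_take_nth_drop[symmetric] take_Suc_conv_app_nth)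
  then obtain q where q: "edges p = edges (take (Suc j) p) @ q" ..
  have "set (edges (take (Suc j) p)) \<subseteq> set (edges p)"
    by (simp add: q)
  then show ?thesis
    using assms by (auto simp: walks_def dest: in_set_takeD)
qed

lemma card_walks_from_le:
  "card {p \<in> walks N b k. hd p = x} \<le> (2 * b + 1) ^ k"
proof (induction k arbitrary: x)
  case 0
  have "{p \<in> walks N b 0. hd p = x} \<subseteq> {[x]}"
    by (auto simp: walks_def length_Suc_conv)
  then show ?case
    using card_mono[of "{[x]}"] by auto
next
  case (Suc k)
  have sub: "{p \<in> walks N b (Suc k). hd p = x} \<subseteq>
      (\<Union>y\<in>{y. near b (x, y)}. (#) x ` {p \<in> walks N b k. hd p = y})"
  proof
    fix p assume p: "p \<in> {p \<in> walks N b (Suc k). hd p = x}"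
    then obtain q where "p = x # q"
      by (cases p) (auto simp: walks_def)
    with p show "p \<in> (\<Union>y\<in>{y. near b (x, y)}. (#) x ` {p \<in> walks N b k. hd p = y})"
      by (auto simp: walks_Suc_iff)
  qed
  have "card {p \<in> walks N b (Suc k). hd p = x} \<le>
      card (\<Union>y\<in>{y. near b (x, y)}. (#) x ` {p \<in> walks N b k. hd p = y})"
    by (rule card_mono[OF _ sub]) simp
  also have "\<dots> \<le> (\<Sum>y\<in>{y. near b (x, y)}. card ((#) x ` {p \<in> walks N b k. hd p = y}))"
    by (rule card_UN_le) simp
  also have "\<dots> \<le> (\<Sum>y\<in>{y. near b (x, y)}. (2 * b + 1) ^ k)"
    by (intro sum_mono order.trans[OF card_image_le] Suc.IH) simp
  also have "\<dots> \<le> (2 * b + 1) * (2 * b + 1) ^ k"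
    using card_near_le[of b x] by (simp del: One_nat_def add: mult_le_mono1)
  finally show ?case
    by simp
qed

section \<open>Counting the walks that reflect a given Dyck word\<close>

definition reflecting :: "bool list \<Rightarrow> nat list \<Rightarrow> bool" where
  "reflecting d p \<longleftrightarrow> parse [] d (map undirected (edges p))"

text \<open>After a prefix of a reflecting walk the stack consists of the edges of a path \<open>v # st\<close> leading
  back to the origin, which is why a pop has to return to \<open>hd st\<close>.\<close>

definition continuations ::
    "nat \<Rightarrow> nat \<Rightarrow> nat \<Rightarrow> nat list \<Rightarrow> bool list \<Rightarrow> nat list set" where
  "continuations N b v st d = {q. v # q \<in> walks N b (length d) \<and>
     parse (map undirected (edges (v # st))) d (map undirected (edges (v # q)))}"

lemma finite_continuations [simp]: "finite (continuations N b v st d)"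
proof -
  have "(#) v ` continuations N b v st d \<subseteq> walks N b (length d)"
    by (auto simp: continuations_def)
  then have "finite ((#) v ` continuations N b v st d)"
    by (rule finite_subset) simp
  then show ?thesis
    by (rule finite_imageD) simp
qed

lemma continuations_Nil:
  "continuations N b v st [] = (if v \<in> {1..N} \<and> st = [] then {[]} else {})"
  by (cases st) (auto simp: continuations_def walks_def)

lemma continuations_True:
  assumes "v \<in> {1..N}"
  shows "continuations N b v st (True # d)
     = (\<Union>x\<in>{x. near b (v, x)}. (#) x ` continuations N b x (v # st) d)"
proof (intro set_eqI iffI)
  fix q assume "q \<in> continuations N b v st (True # d)"
  then show "q \<in> (\<Union>x\<in>{x. near b (v, x)}. (#) x ` continuations N b x (v # st) d)"
    using undirected_commute[of v "hd q"] by (cases q) (auto simp: continuations_def walks_def)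
next
  fix q assume "q \<in> (\<Union>x\<in>{x. near b (v, x)}. (#) x ` continuations N b x (v # st) d)"
  then show "q \<in> continuations N b v st (True # d)"
    using assms undirected_commute[of v "hd q"] by (auto simp: continuations_def walks_def)
qed

text \<open>The top of the stack is the undirected edge \<open>{v, u}\<close>, so the only step from
  \<open>v\<close> that pops it leads to \<open>u\<close>. The case distinction is there because
  \<open>v # u # st\<close> is not assumed to stay in the band.\<close>

lemma continuations_False:
  assumes "v \<in> {1..N}"
  shows "continuations N b v (u # st) (False # d)
     = (if near b (v, u) then (#) u ` continuations N b u st d else {})"
proof (intro set_eqI iffI)
  fix q assume "q \<in> continuations N b v (u # st) (False # d)"
  then show "q \<in> (if near b (v, u) then (#) u ` continuations N b u st d else {})"
    by (cases q) (auto simp: continuations_def walks_def undirected_def doubleton_eq_iff)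
qed (use assms in \<open>auto simp: continuations_def walks_def undirected_def split: if_splits\<close>)

lemma continuations_False_Nil: "continuations N b v [] (False # d) = {}"
  by (auto simp: continuations_def)

lemma continuations_outside: "v \<notin> {1..N} \<Longrightarrow> continuations N b v st d = {}"
  by (auto simp: continuations_def walks_def)

lemma card_continuations_True:
  "v \<in> {1..N} \<Longrightarrow> card (continuations N b v st (True # d))
     = (\<Sum>x\<in>{x. near b (v, x)}. card (continuations N b x (v # st) d))"
  unfolding continuations_True by (subst card_UN_disjoint) (auto simp: card_image)

text \<open>A push leaves at most \<open>2 * b + 1\<close> choices and a pop none, so only the
  letters \<open>True\<close> are charged.\<close>

lemma card_continuations_le:
  "card (continuations N b v st d) \<le> (2 * b + 1) ^ count_list d True"
proof (induction d arbitrary: v st)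
  case Nil
  show ?case
    by (simp add: continuations_Nil)
next
  case (Cons c d)
  show ?case
  proof (cases "v \<in> {1..N}")
    case v: True
    show ?thesis
    proof (cases c)
      case True
      have "card (continuations N b v st (c # d))
          \<le> (\<Sum>x\<in>{x. near b (v, x)}. (2 * b + 1) ^ count_list d True)"
        using True v Cons.IH by (simp only: card_continuations_True sum_mono)
      also have "\<dots> \<le> (2 * b + 1) * (2 * b + 1) ^ count_list d True"
        using card_near_le[of b v] by (simp del: One_nat_def add: mult_le_mono1)
      finally show ?thesis
        using True by simp
    next
      case False
      then show ?thesis
        using Cons.IH v
        by (cases st) (auto simp: continuations_False_Nil continuations_False card_image)
    qed
  qed (simp add: continuations_outside)
qed

text \<open>The margin \<open>length d * b\<close> keeps all remaining steps inside
  \<open>{1..N}\<close>. It is demanded of the whole path \<open>v # st\<close>, since pops return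
  to its vertices, and the path has to lie in the band so that no pop is blocked.\<close>

lemma card_continuations_interior:
  assumes "\<forall>x\<in>set (v # st). length d * b < x \<and> x + length d * b \<le> N"
    and "\<forall>e\<in>set (edges (v # st)). near b e" and "dyck (length st) d"
  shows "card (continuations N b v st d) = (2 * b + 1) ^ count_list d True"
  using assms
proof (induction d arbitrary: v st)
  case Nil
  then show ?case
    by (simp add: continuations_Nil)
next
  case (Cons c d)
  have v: "v \<in> {1..N}"
    using Cons.prems(1) by auto
  have inner: "\<forall>x\<in>set (v # st). length d * b < x \<and> x + length d * b \<le> N"
    using Cons.prems(1) by auto
  show ?case
  proof (cases c)
    case True
    have "card (continuations N b x (v # st) d) = (2 * b + 1) ^ count_list d True"
      if x: "near b (v, x)" for x
    proof (rule Cons.IH)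
      have "length d * b < x \<and> x + length d * b \<le> N"
        using Cons.prems(1) x by (auto simp: near_def)
      with inner show "\<forall>y\<in>set (x # v # st). length d * b < y \<and> y + length d * b \<le> N"
        by simp
      have "near b (x, v)"
        using x near_swap[of b "(v, x)"] by simp
      then show "\<forall>e\<in>set (edges (x # v # st)). near b e"
        using Cons.prems(2) by simp
      show "dyck (length (v # st)) d"
        using Cons.prems(3) True by simp
    qed
    then have "card (continuations N b v st (c # d))
        = (\<Sum>x\<in>{x. near b (v, x)}. (2 * b + 1) ^ count_list d True)"
      using True v by (simp add: card_continuations_True del: One_nat_def)
    also have "\<dots> = (2 * b + 1) * (2 * b + 1) ^ count_list d True"
    proof -
      \<comment> \<open>No truncation at 0 occurs, so the neighbourhood of \<open>v\<close> has
        exactly \<open>2 * b + 1\<close> points.\<close>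
      have "b < v"
        using Cons.prems(1) by auto
      then show ?thesis
        by (simp add: near_set_eq)
    qed
    finally show ?thesis
      using True by simp
  next
    case False
    then obtain u st' where st: "st = u # st'"
      using Cons.prems(3) by (cases st) auto
    have "card (continuations N b u st' d) = (2 * b + 1) ^ count_list d True"
      using Cons.prems inner False st by (intro Cons.IH) auto
    then show ?thesis
      using False v st Cons.prems(2) by (simp add: continuations_False card_image)
  qed
qed

text \<open>A successful parse empties the stack, so the walk finally arrives at the far end of the
  path \<open>v # st\<close>. For empty \<open>st\<close> this is \<open>v\<close> itself.\<close>

lemma last_continuations:
  "q \<in> continuations N b v st d \<Longrightarrow> last (v # q) = last (v # st)"
proof (induction d arbitrary: v st q)
  case Nil
  then show ?case
    by (cases st) (auto simp: continuations_def walks_def)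
next
  case (Cons c d)
  have v: "v \<in> {1..N}"
    using Cons.prems continuations_outside by blast
  show ?case
  proof (cases c)
    case True
    with Cons.prems v obtain x r where "q = x # r" and r: "r \<in> continuations N b x (v # st) d"
      by (auto simp: continuations_True)
    with Cons.IH[OF r] show ?thesis
      by simp
  next
    case False
    with Cons.prems obtain u st' where st: "st = u # st'"
      by (cases st) (auto simp: continuations_False_Nil)
    with False Cons.prems v obtain r where "q = u # r" and r: "r \<in> continuations N b u st' d"
      by (auto simp: continuations_False split: if_splits)
    with Cons.IH[OF r] st show ?thesis
      by simp
  qed
qed

definition reflecting_walks :: "nat \<Rightarrow> nat \<Rightarrow> bool list \<Rightarrow> nat list set" where
  "reflecting_walks N b d = {p \<in> walks N b (length d). reflecting d p}"

lemma reflecting_walks_eq: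
  "reflecting_walks N b d = (\<Union>v\<in>{1..N}. (#) v ` continuations N b v [] d)"
proof (intro set_eqI iffI)
  fix p assume "p \<in> reflecting_walks N b d"
  then show "p \<in> (\<Union>v\<in>{1..N}. (#) v ` continuations N b v [] d)"
    by (cases p) (auto simp: reflecting_walks_def reflecting_def continuations_def walks_def)
qed (auto simp: reflecting_walks_def reflecting_def continuations_def)

lemma card_reflecting_walks:
  "card (reflecting_walks N b d) = (\<Sum>v\<in>{1..N}. card (continuations N b v [] d))"
  unfolding reflecting_walks_eq by (subst card_UN_disjoint) (auto simp: card_image)

lemma card_reflecting_walks_le:
  "card (reflecting_walks N b d) \<le> N * (2 * b + 1) ^ count_list d True"
  unfolding card_reflecting_walks
  using sum_mono[of "{1..N}", OF card_continuations_le[of N b _ "[]" d]] by simp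

lemma card_reflecting_walks_ge:
  assumes "dyck 0 d"
  shows "(N - 2 * (length d * b)) * (2 * b + 1) ^ count_list d True \<le> card (reflecting_walks N b d)"
proof -
  \<comment> \<open>Starting points with room for \<open>length d\<close> steps of size
    \<open>b\<close> on both sides. For small \<open>N\<close> there are none, and the subtraction
    in the claim truncates to 0.\<close>
  let ?I = "{length d * b + 1..N - length d * b}"
  have "(N - 2 * (length d * b)) * (2 * b + 1) ^ count_list d True
      = (\<Sum>v\<in>?I. (2 * b + 1) ^ count_list d True)"
    by simp
  also have "\<dots> = (\<Sum>v\<in>?I. card (continuations N b v [] d))"
    using assms by (intro sum.cong refl card_continuations_interior[symmetric]) auto
  also have "\<dots> \<le> card (reflecting_walks N b d)"
    unfolding card_reflecting_walks by (intro sum_mono2) auto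
  finally show ?thesis .
qed

text \<open>Closedness comes for free, so counts of open reflecting walks can be compared with the
  trace, a sum over closed walks.\<close>

lemma reflecting_closed:
  assumes "p \<in> walks N b k" "reflecting d p"
  shows "last p = hd p"
proof -
  have "p \<in> reflecting_walks N b d"
    using assms parse_imp_dyck[of "[]" d "map undirected (edges p)"]
    by (simp add: reflecting_walks_def reflecting_def walks_def)
  then obtain v q where q: "p = v # q" "q \<in> continuations N b v [] d"
    by (auto simp: reflecting_walks_eq)
  then show ?thesis
    using last_continuations[OF q(2)] by simp
qed

lemma reflecting_dyck: "reflecting d p \<Longrightarrow> d \<in> dyck_words (length p - 1) 0"
  using parse_imp_dyck[of "[]" d "map undirected (edges p)"]
  by (simp add: reflecting_def dyck_words_def)

text \<open>Going out to \<open>y\<close> and back repeats an undirected edge, so a push and a pop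
  can be inserted. Used in contrapositive form: contracting a backtrack does not make a
  non-reflecting walk reflecting.\<close>

lemma reflecting_insert:
  assumes "reflecting d (p @ x # q)"
  shows "\<exists>d'. reflecting d' (p @ x # y # x # q)"
proof -
  have "parse [] d (map undirected (edges (p @ [x])) @ map undirected (edges (x # q)))"
    using assms edges_append[of p x q] by (simp add: reflecting_def)
  from parse_insert_pair[OF this, of "undirected (x, y)"] show ?thesis
    unfolding reflecting_def edges_append[of p x "y # x # q"]
    by (simp only: edges.simps list.map map_append undirected_commute[of y x] append_Cons) blast
qed

section \<open>Walks realising a label word\<close>

text \<open>If the tail of \<open>w\<close> is distinct, the head must recur in it, and everything
  before that recurrence is distinct; otherwise the repetition is sought in the tail. Distinctness
  of \<open>a # x\<close> later makes this stretch worth a full power of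
  \<open>2 * b + 1\<close>.\<close>

lemma not_distinct_decomp_innermost:
  "\<not> distinct w \<Longrightarrow> \<exists>u a x v. w = u @ a # x @ a # v \<and> distinct (a # x)"
proof (induction w)
  case (Cons c w)
  show ?case
  proof (cases "distinct w")
    case True
    with Cons.prems have "c \<in> set w"
      by simp
    then obtain x v where "w = x @ c # v" "c \<notin> set x"
      by (meson split_list_first)
    with True show ?thesis
      by (intro exI[of _ "[]"] exI[of _ c] exI[of _ x] exI[of _ v]) simp
  next
    case False
    with Cons.IH obtain u a x v where "w = u @ a # x @ a # v" "distinct (a # x)"
      by blast
    then show ?thesis
      by (intro exI[of _ "c # u"] exI[of _ a] exI[of _ x] exI[of _ v]) simp
  qed
qed simp

text \<open>One implication only: equal labels force related edges, while related edges may carry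
  different labels. A walk may be coherent with several words, which is harmless for upper
  bounds.\<close>

definition coherent :: "('e \<times> 'e) set \<Rightarrow> 'e list \<Rightarrow> 'l list \<Rightarrow> bool" where
  "coherent R es w \<longleftrightarrow> (\<forall>(e, a)\<in>set (zip es w). \<forall>(e', a')\<in>set (zip es w). a = a' \<longrightarrow> (e, e') \<in> R)"

lemma coherentD:
  "coherent R es w \<Longrightarrow> (e, a) \<in> set (zip es w) \<Longrightarrow> (e', a) \<in> set (zip es w) \<Longrightarrow> (e, e') \<in> R"
  unfolding coherent_def by blast

lemma coherent_mono:
  "coherent R es w \<Longrightarrow> set (zip es' w') \<subseteq> set (zip es w) \<Longrightarrow> coherent R es' w'"
  unfolding coherent_def by blast

definition pair_word :: "'l list \<Rightarrow> bool" where
  "pair_word w \<longleftrightarrow> (\<forall>a\<in>set w. count_list w a = 2)"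

lemma pair_word_length: "pair_word w \<Longrightarrow> length w = 2 * card (set w)"
  using sum_count_set[of w "set w"] by (simp add: pair_word_def)

lemma pair_word_remove:
  assumes "pair_word (u @ a # a # v)"
  shows "a \<notin> set u \<union> set v" and "pair_word (u @ v)"
    and "card (set (u @ a # a # v)) = Suc (card (set (u @ v)))"
proof -
  have "count_list (u @ a # a # v) a = 2"
    using assms unfolding pair_word_def by simp
  then have "count_list u a = 0" "count_list v a = 0"
    by simp_all
  then show a: "a \<notin> set u \<union> set v"
    by (simp add: count_list_0_iff)
  show "pair_word (u @ v)"
    unfolding pair_word_def
  proof
    fix c assume c: "c \<in> set (u @ v)"
    then have "count_list (u @ a # a # v) c = 2"
      using assms unfolding pair_word_def by simp
    moreover have "c \<noteq> a"
      using a c by auto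
    ultimately show "count_list (u @ v) c = 2"
      by simp
  qed
  show "card (set (u @ a # a # v)) = Suc (card (set (u @ v)))"
    using a by simp
qed

text \<open>A single \<open>N\<close>, so that the estimates carry explicit constants.
  \<open>K\<close> plays the part of \<open>B\<close> in (O2); \<open>1 \<le> K\<close> allows its
  exponent to be raised.\<close>

locale index_relation =
  fixes N b K :: nat and R :: "((nat \<times> nat) \<times> (nat \<times> nat)) set"
  assumes equiv: "equiv ({1..N} \<times> {1..N}) R"
    and swap: "p \<in> {1..N} \<Longrightarrow> q \<in> {1..N} \<Longrightarrow> ((p, q), (q, p)) \<in> R"
    and fibre: "p \<in> {1..N} \<Longrightarrow> q \<in> {1..N} \<Longrightarrow> r \<in> {1..N} \<Longrightarrow>
       card {s \<in> {1..N}. ((p, q), (r, s)) \<in> R} \<le> K"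
    and K_pos: "1 \<le> K"
begin

lemma R_sym: "(e, e') \<in> R \<Longrightarrow> (e', e) \<in> R"
  using equiv by (auto simp: equiv_def sym_def)

lemma R_trans: "(e, e') \<in> R \<Longrightarrow> (e', e'') \<in> R \<Longrightarrow> (e, e'') \<in> R"
  using equiv unfolding equiv_def trans_def by blast

lemma R_carrier: "(e, e') \<in> R \<Longrightarrow> e \<in> {1..N} \<times> {1..N} \<and> e' \<in> {1..N} \<times> {1..N}"
  using equiv by (auto simp: equiv_def refl_on_def)

lemma R_swap: "e \<in> {1..N} \<times> {1..N} \<Longrightarrow> (e, prod.swap e) \<in> R"
  using swap by (cases e) auto

lemma R_swap_swap: "(e, e') \<in> R \<Longrightarrow> (prod.swap e, prod.swap e') \<in> R"
  using R_carrier R_swap R_sym R_trans by meson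

definition coherent_walks :: "'l list \<Rightarrow> nat list set" where
  "coherent_walks w = {p \<in> walks N b (length w). coherent R (edges p) w}"

lemma finite_coherent_walks [simp]: "finite (coherent_walks w)"
  by (simp add: coherent_walks_def)

lemma coherent_walks_ConsD:
  "x # p \<in> coherent_walks (a # w) \<Longrightarrow> p \<in> coherent_walks w"
proof -
  assume xp: "x # p \<in> coherent_walks (a # w)"
  then obtain y q where p: "p = y # q"
    by (cases p) (auto simp: coherent_walks_def walks_def)
  have "coherent R (edges p) w"
    by (rule coherent_mono[of R "edges (x # p)" "a # w"])
      (use xp in \<open>auto simp: coherent_walks_def p\<close>)
  with xp show ?thesis
    by (simp add: coherent_walks_def walks_Suc_iff)
qed

lemma coherent_walks_appendD:
  "p \<in> coherent_walks (u @ w) \<Longrightarrow> drop (length u) p \<in> coherent_walks w"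
proof (induction u arbitrary: p)
  case (Cons c u)
  then obtain x q where p: "p = x # q"
    by (cases p) (auto simp: coherent_walks_def walks_def)
  then show ?case
    using Cons.IH[of q] coherent_walks_ConsD[of x q c "u @ w"] Cons.prems by simp
qed simp

lemma coherent_rev:
  assumes "length es = length w" "coherent R es w"
  shows "coherent R (rev (map prod.swap es)) (rev w)"
proof -
  have "zip (rev (map prod.swap es)) (rev w) = rev (map (\<lambda>(e, a). (prod.swap e, a)) (zip es w))"
    using assms(1) by (simp add: zip_rev zip_map1)
  then have "set (zip (rev (map prod.swap es)) (rev w)) = (\<lambda>(e, a). (prod.swap e, a)) ` set (zip es w)"
    by simp
  then show ?thesis
    using R_swap_swap coherentD[OF assms(2)] by (auto simp: coherent_def)
qed

text \<open>Reversing walk and word turns an extension to the right into one to the left, so only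
  the latter has to be counted by induction.\<close>

lemma rev_coherent_walks: "p \<in> coherent_walks w \<Longrightarrow> rev p \<in> coherent_walks (rev w)"
  using coherent_rev[of "edges p" w] by (auto simp: coherent_walks_def edges_rev walks_def)

text \<open>A repeated label ties the new edge to an earlier one, and (O2) leaves at most
  \<open>K\<close> choices for its free end point; a new label is limited only by the band.\<close>

lemma card_extend_Cons_fibre:
  assumes "p \<in> coherent_walks w"
  shows "card {x. x # p \<in> coherent_walks (a # w)} \<le> (if a \<in> set w then K else 2 * b + 1)"
proof -
  obtain y p' where p: "p = y # p'"
    using assms by (cases p) (auto simp: coherent_walks_def walks_def)
  have y: "y \<in> {1..N}"
    using assms p by (auto simp: coherent_walks_def walks_def)
  show ?thesis
  proof (cases "a \<in> set w")
    case True
    have "length (edges p) = length w"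
      using assms by (simp add: coherent_walks_def walks_def)
    then obtain e where e: "(e, a) \<in> set (zip (edges p) w)"
      using True by (metis in_set_impl_in_set_zip2)
    then have "e \<in> set (edges p)"
      by (meson set_zip_leftD)
    moreover have "set p \<subseteq> {1..N}"
      using assms by (simp add: coherent_walks_def walks_def)
    ultimately have "e \<in> {1..N} \<times> {1..N}"
      using set_edges_subset[of p] by blast
    then obtain r s where rs: "e = (r, s)" "r \<in> {1..N}" "s \<in> {1..N}"
      by blast
    have "{x. x # p \<in> coherent_walks (a # w)} \<subseteq> {x \<in> {1..N}. ((r, s), (y, x)) \<in> R}"
    proof
      fix x assume "x \<in> {x. x # p \<in> coherent_walks (a # w)}"
      then have x: "x \<in> {1..N}" and c: "coherent R ((x, y) # edges p) (a # w)"
        by (auto simp: coherent_walks_def walks_def p)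
      have "(e, (x, y)) \<in> R"
        using coherentD[OF c, of e a "(x, y)"] e by simp
      \<comment> \<open>(O2) prescribes the first vertex of the second edge. The known vertex
        \<open>y\<close> comes second in \<open>(x, y)\<close>, so the edge has to be
        reversed.\<close>
      then have "(e, (y, x)) \<in> R"
        using R_trans swap[OF x y] by blast
      then show "x \<in> {x \<in> {1..N}. ((r, s), (y, x)) \<in> R}"
        using x rs by simp
    qed
    then have "card {x. x # p \<in> coherent_walks (a # w)} \<le> card {x \<in> {1..N}. ((r, s), (y, x)) \<in> R}"
      by (intro card_mono) auto
    also have "\<dots> \<le> K"
      using fibre rs y by blast
    finally show ?thesis
      using True by simp
  next
    case False
    have "{x. x # p \<in> coherent_walks (a # w)} \<subseteq> {x. near b (y, x)}"
      using near_swap[of b "(y, _)"] by (auto simp: coherent_walks_def walks_def p)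
    then have "card {x. x # p \<in> coherent_walks (a # w)} \<le> card {x. near b (y, x)}"
      by (intro card_mono) auto
    with False card_near_le[of b y] show ?thesis
      by simp
  qed
qed

lemma card_extend_Cons:
  assumes "S \<subseteq> coherent_walks w"
  shows "card {p \<in> coherent_walks (a # w). tl p \<in> S}
       \<le> (if a \<in> set w then K else 2 * b + 1) * card S"
proof -
  let ?X = "\<lambda>p. {x. x # p \<in> coherent_walks (a # w)}"
  have fin: "finite S"
    using assms by (rule finite_subset) simp
  have finX: "finite (?X p)" for p
    by (rule finite_subset[of _ "{1..N}"]) (auto simp: coherent_walks_def walks_def)
  have "{p \<in> coherent_walks (a # w). tl p \<in> S} \<subseteq> (\<Union>p\<in>S. (\<lambda>x. x # p) ` ?X p)"
  proof
    fix p assume p: "p \<in> {p \<in> coherent_walks (a # w). tl p \<in> S}"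
    then obtain x q where "p = x # q"
      by (cases p) (auto simp: coherent_walks_def walks_def)
    with p show "p \<in> (\<Union>p\<in>S. (\<lambda>x. x # p) ` ?X p)"
      by auto
  qed
  then have "card {p \<in> coherent_walks (a # w). tl p \<in> S} \<le> card (\<Union>p\<in>S. (\<lambda>x. x # p) ` ?X p)"
    using fin finX by (intro card_mono) auto
  also have "\<dots> \<le> (\<Sum>p\<in>S. card ((\<lambda>x. x # p) ` ?X p))"
    by (rule card_UN_le[OF fin])
  also have "\<dots> \<le> (\<Sum>p\<in>S. (if a \<in> set w then K else 2 * b + 1))"
    using assms finX
    by (intro sum_mono order.trans[OF card_image_le card_extend_Cons_fibre]) auto
  finally show ?thesis
    by (simp add: mult.commute)
qed

text \<open>Vertices are added from right to left: a letter costs \<open>2 * b + 1\<close> when it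
  is met for the first time and \<open>K\<close> afterwards.\<close>

lemma card_extend_left:
  assumes S: "S \<subseteq> coherent_walks w"
  shows "card {p \<in> coherent_walks (u @ w). drop (length u) p \<in> S}
       \<le> K ^ length u * (2 * b + 1) ^ card (set u - set w) * card S"
proof (induction u)
  case Nil
  then show ?case
    using card_mono[OF finite_subset[OF S finite_coherent_walks], of "{p \<in> coherent_walks w. p \<in> S}"]
    by auto
next
  case (Cons a u)
  let ?S' = "{p \<in> coherent_walks (u @ w). drop (length u) p \<in> S}"
  let ?c = "if a \<in> set (u @ w) then K else 2 * b + 1"
  have "{p \<in> coherent_walks ((a # u) @ w). drop (length (a # u)) p \<in> S}
      \<subseteq> {p \<in> coherent_walks (a # u @ w). tl p \<in> ?S'}"
  proof
    fix p assume p: "p \<in> {p \<in> coherent_walks ((a # u) @ w). drop (length (a # u)) p \<in> S}"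
    then obtain x q where "p = x # q"
      by (cases p) (auto simp: coherent_walks_def walks_def)
    with p show "p \<in> {p \<in> coherent_walks (a # u @ w). tl p \<in> ?S'}"
      using coherent_walks_ConsD by auto
  qed
  then have "card {p \<in> coherent_walks ((a # u) @ w). drop (length (a # u)) p \<in> S}
      \<le> card {p \<in> coherent_walks (a # u @ w). tl p \<in> ?S'}"
    by (intro card_mono) auto
  also have "\<dots> \<le> ?c * card ?S'"
    by (intro card_extend_Cons) auto
  also have "\<dots> \<le> ?c * (K ^ length u * (2 * b + 1) ^ card (set u - set w) * card S)"
    by (intro mult_left_mono Cons.IH) simp
  also have "\<dots> \<le> K ^ length (a # u) * (2 * b + 1) ^ card (set (a # u) - set w) * card S"
  proof (cases "a \<in> set (u @ w)")
    case True
    then have "set (a # u) - set w = set u - set w"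
      by auto
    with True show ?thesis
      by simp
  next
    case False
    then have "set (a # u) - set w = insert a (set u - set w)" "a \<notin> set u - set w"
      by auto
    then have "card (set (a # u) - set w) = Suc (card (set u - set w))"
      by simp
    with False have "?c * (K ^ length u * (2 * b + 1) ^ card (set u - set w) * card S)
       = 1 * (K ^ length u * (2 * b + 1) ^ card (set (a # u) - set w) * card S)"
      by (simp add: mult_ac)
    \<comment> \<open>A new letter is charged a surplus factor \<open>K\<close>, which keeps the
      exponent of \<open>K\<close> equal to the length.\<close>
    also have "\<dots> \<le> K * (K ^ length u * (2 * b + 1) ^ card (set (a # u) - set w) * card S)"
      using K_pos by (intro mult_right_mono) auto
    finally show ?thesis
      by (simp add: mult_ac)
  qed
  finally show ?case .
qed

lemma card_extend_right:
  assumes S: "S \<subseteq> coherent_walks w"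
  shows "card {p \<in> coherent_walks (w @ v). take (Suc (length w)) p \<in> S}
       \<le> K ^ length v * (2 * b + 1) ^ card (set v - set w) * card S"
proof -
  have "rev ` {p \<in> coherent_walks (w @ v). take (Suc (length w)) p \<in> S}
      \<subseteq> {p \<in> coherent_walks (rev v @ rev w). drop (length (rev v)) p \<in> rev ` S}"
  proof (clarify)
    fix p assume p: "p \<in> coherent_walks (w @ v)" "take (Suc (length w)) p \<in> S"
    then have "length p = Suc (length w + length v)"
      by (simp add: coherent_walks_def walks_def)
    then have "drop (length v) (rev p) = rev (take (Suc (length w)) p)"
      by (simp add: drop_rev)
    then show "rev p \<in> coherent_walks (rev v @ rev w) \<and> drop (length (rev v)) (rev p) \<in> rev ` S"
      using rev_coherent_walks[OF p(1)] p(2) by simp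
  qed
  then have "card (rev ` {p \<in> coherent_walks (w @ v). take (Suc (length w)) p \<in> S})
      \<le> card {p \<in> coherent_walks (rev v @ rev w). drop (length (rev v)) p \<in> rev ` S}"
    by (intro card_mono) auto
  also have "\<dots> \<le> K ^ length (rev v) * (2 * b + 1) ^ card (set (rev v) - set (rev w)) * card (rev ` S)"
    using S rev_coherent_walks by (intro card_extend_left) auto
  finally show ?thesis
    by (simp add: card_image)
qed

text \<open>The block \<open>w\<close> serves as an anchor: a saving in the number of walks along it
  survives in every word containing it as a factor, since letters of \<open>w\<close> cost no
  further power of \<open>2 * b + 1\<close>.\<close>

lemma card_extend:
  assumes S: "S \<subseteq> coherent_walks w"
  shows "card {p \<in> coherent_walks (u @ w @ v). take (Suc (length w)) (drop (length u) p) \<in> S}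
       \<le> K ^ (length u + length v) * (2 * b + 1) ^ card (set u \<union> set v - set w) * card S"
proof -
  let ?S' = "{p \<in> coherent_walks (w @ v). take (Suc (length w)) p \<in> S}"
  have "card {p \<in> coherent_walks (u @ w @ v). take (Suc (length w)) (drop (length u) p) \<in> S}
      \<le> card {p \<in> coherent_walks (u @ w @ v). drop (length u) p \<in> ?S'}"
    using coherent_walks_appendD by (intro card_mono) auto
  also have "\<dots> \<le> K ^ length u * (2 * b + 1) ^ card (set u - set (w @ v)) * card ?S'"
    by (intro card_extend_left) auto
  also have "\<dots> \<le> K ^ length u * (2 * b + 1) ^ card (set u - set (w @ v))
      * (K ^ length v * (2 * b + 1) ^ card (set v - set w) * card S)"
    by (intro mult_left_mono card_extend_right S) simp
  also have "\<dots> = K ^ (length u + length v) * (2 * b + 1) ^ card (set u \<union> set v - set w) * card S"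
  proof -
    have "set u \<union> set v - set w = (set u - set (w @ v)) \<union> (set v - set w)"
      by auto
    then have "card (set u \<union> set v - set w) = card (set u - set (w @ v)) + card (set v - set w)"
      by (simp, subst card_Un_disjoint) auto
    then show ?thesis
      by (simp add: power_add mult_ac)
  qed
  finally show ?thesis .
qed

text \<open>The anchor is the empty block, with the \<open>N\<close> one-vertex walks.\<close>

lemma card_coherent_walks_le:
  "card (coherent_walks w) \<le> K ^ length w * (2 * b + 1) ^ card (set w) * N"
proof -
  let ?S = "(\<lambda>x. [x]) ` {1..N}"
  have S: "?S \<subseteq> coherent_walks ([] :: 'a list)"
    by (auto simp: coherent_walks_def walks_def coherent_def)
  have "coherent_walks w \<subseteq> {p \<in> coherent_walks ([] @ w). take (Suc (length ([] :: 'a list))) p \<in> ?S}"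
  proof
    fix p assume p: "p \<in> coherent_walks w"
    then show "p \<in> {p \<in> coherent_walks ([] @ w). take (Suc (length ([] :: 'a list))) p \<in> ?S}"
      by (cases p) (auto simp: coherent_walks_def walks_def)
  qed
  then have "card (coherent_walks w)
      \<le> card {p \<in> coherent_walks ([] @ w). take (Suc (length ([] :: 'a list))) p \<in> ?S}"
    by (intro card_mono) auto
  also have "\<dots> \<le> K ^ length w * (2 * b + 1) ^ card (set w - set []) * card ?S"
    by (rule card_extend_right[OF S])
  also have "card ?S = N"
    by (simp add: card_image inj_on_def)
  finally show ?thesis
    by simp
qed

end

section \<open>Savings from (O1) and (O3)\<close>

context index_relation
begin

lemma coherent_walks_takeD:
  assumes "p \<in> coherent_walks (w @ v)"
  shows "take (Suc (length w)) p \<in> coherent_walks w"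
proof -
  have "length p = Suc (length w + length v)"
    using assms by (simp add: coherent_walks_def walks_def)
  then have "drop (length (rev v)) (rev p) = rev (take (Suc (length w)) p)"
    by (simp add: drop_rev)
  then have "rev (take (Suc (length w)) p) \<in> coherent_walks (rev w)"
    using coherent_walks_appendD[of "rev p" "rev v" "rev w"] rev_coherent_walks[OF assms] by simp
  then show ?thesis
    using rev_coherent_walks by fastforce
qed

text \<open>The edges labelled \<open>a\<close> determine both end points of the stretch \<open>x\<close>, so one of its vertices
  is no longer free.\<close>

lemma card_coherent_walks_loop:
  assumes D1: "\<And>p. p \<in> {1..N} \<Longrightarrow> card {(q, r, s). q \<in> {1..N} \<and> r \<in> {1..N} \<and> s \<in> {1..N}
                                   \<and> ((p, q), (r, s)) \<in> R} \<le> D1"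
    and "x \<noteq> []"
  shows "card (coherent_walks (a # x @ [a])) \<le> N * D1 * (2 * b + 1) ^ (length x - 1)"
proof -
  \<comment> \<open>A walk consists of \<open>p\<close>, then \<open>length x\<close> vertices
    \<open>ys\<close> beginning with \<open>q\<close>, then \<open>r\<close> and \<open>s\<close>.
    The triple has at most \<open>D1\<close> choices and \<open>ys\<close> only
    \<open>length x - 1\<close> free steps; the step from \<open>last ys\<close> to \<open>r\<close>
    costs nothing, as \<open>r\<close> is already chosen.\<close>
  let ?T = "\<lambda>p. {(q, r, s). q \<in> {1..N} \<and> r \<in> {1..N} \<and> s \<in> {1..N} \<and> ((p, q), (r, s)) \<in> R}"
  let ?W = "\<lambda>q. {ys \<in> walks N b (length x - 1). hd ys = q}"
  let ?F = "\<lambda>p t. (\<lambda>ys. p # ys @ [fst (snd t), snd (snd t)]) ` ?W (fst t)"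
  have finT: "finite (?T p)" for p
    by (rule finite_subset[of _ "{1..N} \<times> {1..N} \<times> {1..N}"]) auto
  have "coherent_walks (a # x @ [a]) \<subseteq> (\<Union>p\<in>{1..N}. \<Union>t\<in>?T p. ?F p t)"
  proof
    fix p assume p: "p \<in> coherent_walks (a # x @ [a])"
    then have len: "length p = length x + 3"
      by (simp add: coherent_walks_def walks_def)
    then obtain p0 p' where p': "p = p0 # p'" "length p' = length x + 2"
      by (cases p) auto
    define ys where "ys = take (length x) p'"
    have "length (drop (length x) p') = Suc (Suc 0)"
      using p' by simp
    then obtain r s where "drop (length x) p' = [r, s]"
      unfolding length_Suc_conv by auto
    then have p'': "p' = ys @ [r, s]" and ys: "length ys = length x"
      using append_take_drop_id[of "length x" p'] p'(2) by (auto simp: ys_def)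
    obtain q ys' where q: "ys = q # ys'"
      using ys \<open>x \<noteq> []\<close> by (cases ys) auto
    have walk: "p \<in> walks N b (Suc (Suc (length x)))" and coh: "coherent R (edges p) (a # x @ [a])"
      using p by (auto simp: coherent_walks_def)
    have "p' \<in> walks N b (Suc (length x))"
      using walk unfolding p' by (simp add: walks_Suc_iff)
    then have "take (Suc (length x - 1)) p' \<in> walks N b (length x - 1)"
      by (rule take_in_walks) simp
    then have W: "ys \<in> ?W q"
      using \<open>x \<noteq> []\<close> q by (simp add: ys_def)
    have "edges p = edges ((p0 # ys) @ [r]) @ edges [r, s]"
      using edges_append[of "p0 # ys" r "[s]"] by (simp add: p' p'')
    then have e: "edges p = (edges ((p0 # ys) @ [r])) @ [(r, s)]"
      by simp
    have "length (edges ((p0 # ys) @ [r])) = length (a # x)"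
      using ys by simp
    then have "zip (edges p) ((a # x) @ [a]) = zip (edges ((p0 # ys) @ [r])) (a # x) @ [((r, s), a)]"
      unfolding e by (subst zip_append) auto
    then have "((p0, q), a) \<in> set (zip (edges p) (a # x @ [a]))"
      and "((r, s), a) \<in> set (zip (edges p) (a # x @ [a]))"
      by (auto simp: q)
    then have "((p0, q), (r, s)) \<in> R"
      using coherentD[OF coh] by blast
    moreover have "set p \<subseteq> {1..N}"
      using walk by (simp add: walks_def)
    ultimately have "p0 \<in> {1..N}" "(q, r, s) \<in> ?T p0"
      by (auto simp: p' p'' q)
    moreover have "p \<in> ?F p0 (q, r, s)"
      using W p' p'' by auto
    ultimately show "p \<in> (\<Union>p\<in>{1..N}. \<Union>t\<in>?T p. ?F p t)"
      by blast
  qed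
  then have "card (coherent_walks (a # x @ [a])) \<le> card (\<Union>p\<in>{1..N}. \<Union>t\<in>?T p. ?F p t)"
    using finT by (intro card_mono) auto
  also have "\<dots> \<le> (\<Sum>p\<in>{1..N}. card (\<Union>t\<in>?T p. ?F p t))"
    by (rule card_UN_le) simp
  also have "\<dots> \<le> (\<Sum>p\<in>{1..N}. D1 * (2 * b + 1) ^ (length x - 1))"
  proof (rule sum_mono)
    fix p assume p: "p \<in> {1..N}"
    have "card (\<Union>t\<in>?T p. ?F p t) \<le> (\<Sum>t\<in>?T p. card (?F p t))"
      by (rule card_UN_le[OF finT])
    also have "\<dots> \<le> (\<Sum>t\<in>?T p. (2 * b + 1) ^ (length x - 1))"
      by (intro sum_mono order.trans[OF card_image_le card_walks_from_le]) simp
    also have "\<dots> = card (?T p) * (2 * b + 1) ^ (length x - 1)"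
      by simp
    also have "\<dots> \<le> D1 * (2 * b + 1) ^ (length x - 1)"
      using D1[OF p] by (intro mult_right_mono) auto
    finally show "card (\<Union>t\<in>?T p. ?F p t) \<le> D1 * (2 * b + 1) ^ (length x - 1)" .
  qed
  finally show ?thesis
    by simp
qed

text \<open>By distinctness the block \<open>a x a\<close> has \<open>length x + 1\<close> letters,
  worth \<open>(2b+1)^(length x + 1)\<close> in the bound from (O2); the preceding lemma replaces
  this by \<open>D1 * (2b+1)^(length x - 1)\<close>. The factor \<open>(2 * b + 1)^2\<close> on the
  left expresses the gain without dividing natural numbers.\<close>

lemma card_coherent_walks_long_loop:
  assumes D1: "\<And>p. p \<in> {1..N} \<Longrightarrow> card {(q, r, s). q \<in> {1..N} \<and> r \<in> {1..N} \<and> s \<in> {1..N}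
                                   \<and> ((p, q), (r, s)) \<in> R} \<le> D1"
    and x: "x \<noteq> []" "distinct (a # x)" and w: "w = u @ a # x @ a # v"
  shows "(2 * b + 1)\<^sup>2 * card (coherent_walks w)
     \<le> K ^ length w * (2 * b + 1) ^ card (set w) * (N * D1)"
proof -
  let ?y = "a # x @ [a]"
  let ?r = "card (set u \<union> set v - set ?y)"
  have w': "w = u @ ?y @ v"
    using w by simp
  have "coherent_walks w \<subseteq>
      {p \<in> coherent_walks (u @ ?y @ v). take (Suc (length ?y)) (drop (length u) p) \<in> coherent_walks ?y}"
    using coherent_walks_takeD coherent_walks_appendD unfolding w' by blast
  then have "card (coherent_walks w) \<le> card {p \<in> coherent_walks (u @ ?y @ v).
      take (Suc (length ?y)) (drop (length u) p) \<in> coherent_walks ?y}"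
    by (intro card_mono) auto
  also have "\<dots> \<le> K ^ (length u + length v) * (2 * b + 1) ^ ?r * card (coherent_walks ?y)"
    by (rule card_extend) simp
  also have "\<dots> \<le> K ^ (length u + length v) * (2 * b + 1) ^ ?r
      * (N * D1 * (2 * b + 1) ^ (length x - 1))"
    by (intro mult_left_mono card_coherent_walks_loop D1 x) auto
  finally have "(2 * b + 1)\<^sup>2 * card (coherent_walks w) \<le> (2 * b + 1)\<^sup>2 *
      (K ^ (length u + length v) * (2 * b + 1) ^ ?r * (N * D1 * (2 * b + 1) ^ (length x - 1)))"
    by (intro mult_left_mono) auto
  also have "\<dots> = K ^ (length u + length v) * (2 * b + 1) ^ (2 + ?r + (length x - 1)) * (N * D1)"
    by (simp only: power_add mult_ac)
  also have "2 + ?r + (length x - 1) = card (set w)"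
  proof -
    have "set w = (set u \<union> set v - set ?y) \<union> set (a # x)"
      unfolding w' by auto
    also have "card \<dots> = ?r + card (set (a # x))"
      by (rule card_Un_disjoint) auto
    also have "card (set (a # x)) = Suc (length x)"
      using x(2) distinct_card by fastforce
    finally show ?thesis
      using x(1) by (cases x) auto
  qed
  also have "K ^ (length u + length v) * (2 * b + 1) ^ card (set w) * (N * D1)
      \<le> K ^ length w * (2 * b + 1) ^ card (set w) * (N * D1)"
    using K_pos unfolding w by (intro mult_right_mono power_increasing) auto
  finally show ?thesis .
qed

text \<open>The anchor is the block \<open>a a\<close> with different end points. Its walks are
  triples as in (O3), against an order of \<open>N * (2 * b + 1)\<close> without that
  restriction.\<close>

lemma card_backtrack_failure:
  "card {p \<in> coherent_walks (u @ a # a # v). p ! length u \<noteq> p ! (length u + 2)}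
     \<le> K ^ (length u + length v) * (2 * b + 1) ^ card (set u \<union> set v - {a})
       * card {(p, q, r). p \<in> {1..N} \<and> q \<in> {1..N} \<and> r \<in> {1..N} \<and> ((p, q), (q, r)) \<in> R \<and> r \<noteq> p}"
    (is "card ?L \<le> _ * card ?D")
proof -
  let ?S = "{p \<in> coherent_walks [a, a]. p ! 0 \<noteq> p ! 2}"
  have "?L \<subseteq> {p \<in> coherent_walks (u @ [a, a] @ v). take (Suc (length [a, a])) (drop (length u) p) \<in> ?S}"
  proof
    fix p assume p: "p \<in> ?L"
    then have "length p = length u + length v + 3"
      by (simp add: coherent_walks_def walks_def)
    moreover have "take (Suc (length [a, a])) (drop (length u) p) \<in> coherent_walks [a, a]"
      using p coherent_walks_takeD[of "drop (length u) p" "[a, a]" v]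
        coherent_walks_appendD[of p u "[a, a] @ v"] by simp
    ultimately show "p \<in> {p \<in> coherent_walks (u @ [a, a] @ v).
        take (Suc (length [a, a])) (drop (length u) p) \<in> ?S}"
      using p by simp
  qed
  then have "card ?L \<le> card {p \<in> coherent_walks (u @ [a, a] @ v).
      take (Suc (length [a, a])) (drop (length u) p) \<in> ?S}"
    by (intro card_mono) auto
  also have "\<dots> \<le> K ^ (length u + length v) * (2 * b + 1) ^ card (set u \<union> set v - set [a, a]) * card ?S"
    by (rule card_extend) auto
  also have "card ?S \<le> card ?D"
  proof -
    have "?S \<subseteq> (\<lambda>(p, q, r). [p, q, r]) ` ?D"
    proof
      fix p assume p: "p \<in> ?S"
      then have "length p = Suc (Suc (Suc 0))"
        by (simp add: coherent_walks_def walks_def)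
      then obtain x y z where xyz: "p = [x, y, z]"
        unfolding length_Suc_conv by auto
      have "((x, y), (y, z)) \<in> R"
        using p coherentD[of R "edges p" "[a, a]" "(x, y)" a "(y, z)"]
        by (simp add: coherent_walks_def xyz)
      with p have "(x, y, z) \<in> ?D"
        by (auto simp: coherent_walks_def walks_def xyz)
      then show "p \<in> (\<lambda>(p, q, r). [p, q, r]) ` ?D"
        unfolding xyz by (rule rev_image_eqI) simp
    qed
    moreover have "finite ?D"
      by (rule finite_subset[of _ "{1..N} \<times> {1..N} \<times> {1..N}"]) auto
    ultimately show ?thesis
      by (rule surj_card_le[rotated])
  qed
  finally show ?thesis
    by simp
qed

definition bad_walks :: "'l list \<Rightarrow> nat list set" where
  "bad_walks w = {p \<in> coherent_walks w. \<nexists>d. reflecting d p}"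

lemma finite_bad_walks [simp]: "finite (bad_walks w)"
  by (simp add: bad_walks_def)

text \<open>Write the walk as \<open>p1 x y x p2\<close> and delete \<open>y\<close> and one copy of
  \<open>x\<close>; by \<open>reflecting_insert\<close> the result is still not reflecting. In the
  recovery of \<open>p\<close>, \<open>take\<close> and \<open>drop\<close> overlap in the vertex at
  position \<open>length u\<close>, which supplies both copies of \<open>x\<close>.\<close>

lemma backtrack_contract:
  assumes p: "p \<in> bad_walks (u @ a # a # v)" and eq: "p ! length u = p ! (length u + 2)"
  shows "\<exists>q\<in>bad_walks (u @ v). \<exists>y. near b (q ! length u, y)
           \<and> p = take (Suc (length u)) q @ y # drop (length u) q"
proof -
  have walk: "p \<in> walks N b (length (u @ a # a # v))" and coh: "coherent R (edges p) (u @ a # a # v)"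
    using p by (auto simp: bad_walks_def coherent_walks_def)
  then have len: "length p = length u + length v + 3"
    by (simp add: walks_def)
  define p1 where "p1 = take (length u) p"
  have len1: "length p1 = length u"
    using len by (simp add: p1_def)
  have "length (drop (length u) p) = Suc (Suc (Suc (length v)))"
    using len by simp
  then obtain x y z p2 where xyz: "drop (length u) p = x # y # z # p2"
    unfolding length_Suc_conv by auto
  then have "p = p1 @ x # y # z # p2"
    using append_take_drop_id[of "length u" p] by (simp add: p1_def)
  moreover have "x = z"
    using eq calculation len1 by (simp add: nth_append)
  ultimately have pp: "p = p1 @ x # y # x # p2"
    by simp
  let ?q = "p1 @ x # p2"
  have ep: "edges p = edges (p1 @ [x]) @ (x, y) # (y, x) # edges (x # p2)"
    using edges_append[of p1 x "y # x # p2"] by (simp add: pp)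
  have eq: "edges ?q = edges (p1 @ [x]) @ edges (x # p2)"
    by (rule edges_append)
  have l: "length (edges (p1 @ [x])) = length u"
    using len1 by simp
  have "coherent R (edges ?q) (u @ v)"
    by (rule coherent_mono[OF coh]) (auto simp: ep eq zip_append[OF l])
  moreover have "?q \<in> walks N b (length (u @ v))"
    using walk by (auto simp: walks_def pp ep[unfolded pp] eq)
  moreover have "\<not> reflecting d ?q" for d
    using p reflecting_insert[of d p1 x p2 y] by (auto simp: bad_walks_def pp)
  ultimately have "?q \<in> bad_walks (u @ v)"
    by (auto simp: bad_walks_def coherent_walks_def)
  moreover have "near b (?q ! length u, y)"
    using walk len1 by (auto simp: walks_def ep nth_append)
  moreover have "p = take (Suc (length u)) ?q @ y # drop (length u) ?q"
    using len1 by (simp add: pp)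
  ultimately show ?thesis
    by blast
qed

text \<open>The contraction forgets only \<open>y\<close>, a band neighbour of a vertex that
  remains, so it is at most \<open>2 * b + 1\<close> to one.\<close>

lemma card_bad_walks_backtrack:
  "card (bad_walks (u @ a # a # v))
     \<le> K ^ (length u + length v) * (2 * b + 1) ^ card (set u \<union> set v - {a})
       * card {(p, q, r). p \<in> {1..N} \<and> q \<in> {1..N} \<and> r \<in> {1..N} \<and> ((p, q), (q, r)) \<in> R \<and> r \<noteq> p}
     + (2 * b + 1) * card (bad_walks (u @ v))"
proof -
  let ?L = "{p \<in> coherent_walks (u @ a # a # v). p ! length u \<noteq> p ! (length u + 2)}"
  let ?I = "\<lambda>q. (\<lambda>y. take (Suc (length u)) q @ y # drop (length u) q) ` {y. near b (q ! length u, y)}"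
  let ?M = "\<Union>q\<in>bad_walks (u @ v). ?I q"
  have "bad_walks (u @ a # a # v) \<subseteq> ?L \<union> ?M"
  proof
    fix p assume p: "p \<in> bad_walks (u @ a # a # v)"
    show "p \<in> ?L \<union> ?M"
    proof (cases "p ! length u = p ! (length u + 2)")
      case True
      then show ?thesis
        using backtrack_contract[OF p] by blast
    next
      case False
      then show ?thesis
        using p by (simp add: bad_walks_def)
    qed
  qed
  then have "card (bad_walks (u @ a # a # v)) \<le> card (?L \<union> ?M)"
    by (intro card_mono) auto
  also have "\<dots> \<le> card ?L + card ?M"
    by (rule card_Un_le)
  also have "card ?M \<le> (\<Sum>q\<in>bad_walks (u @ v). card (?I q))"
    by (rule card_UN_le) simp
  also have "\<dots> \<le> (\<Sum>q\<in>bad_walks (u @ v). 2 * b + 1)"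
    by (intro sum_mono order.trans[OF card_image_le card_near_le]) simp
  also have "\<dots> = (2 * b + 1) * card (bad_walks (u @ v))"
    by simp
  finally show ?thesis
    using card_backtrack_failure[of u a v] by linarith
qed

text \<open>Removing an adjacent pair costs one (O3) error and one factor \<open>2 * b + 1\<close>,
  the share of the removed letter; a longer stretch ends the recursion with the (O1) error. At most
  one error per letter accumulates, hence the factor \<open>card (set w)\<close>.\<close>

lemma card_bad_walks_le:
  assumes D1: "\<And>p. p \<in> {1..N} \<Longrightarrow> card {(q, r, s). q \<in> {1..N} \<and> r \<in> {1..N} \<and> s \<in> {1..N}
                                   \<and> ((p, q), (r, s)) \<in> R} \<le> D1"
    and D3: "card {(p, q, r). p \<in> {1..N} \<and> q \<in> {1..N} \<and> r \<in> {1..N}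
                                   \<and> ((p, q), (q, r)) \<in> R \<and> r \<noteq> p} \<le> D3"
    and "pair_word w"
  shows "(2 * b + 1)\<^sup>2 * card (bad_walks w)
     \<le> card (set w) * (K ^ length w * (2 * b + 1) ^ card (set w) * ((2 * b + 1) * D3 + N * D1))"
  using \<open>pair_word w\<close>
proof (induction "length w" arbitrary: w rule: less_induct)
  case less
  define c where "c = 2 * b + 1"
  let ?D = "c * D3 + N * D1"
  have "c\<^sup>2 * card (bad_walks w) \<le> card (set w) * (K ^ length w * c ^ card (set w) * ?D)"
  proof (cases "w = []")
    case True
    \<comment> \<open>A one-vertex walk reflects the empty Dyck word, so the induction starts
      without bad walks.\<close>
    have "reflecting [] p" if "p \<in> coherent_walks []" for p
    proof -
      have "length p = Suc 0"
        using that by (simp add: coherent_walks_def walks_def)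
      then show ?thesis
        by (auto simp: length_Suc_conv reflecting_def)
    qed
    then have "bad_walks w = {}"
      using True by (auto simp: bad_walks_def)
    then show ?thesis
      by simp
  next
    case False
    have "card (set w) > 0"
      using False by (simp add: card_gt_0_iff)
    then have "\<not> distinct w"
      using pair_word_length[OF less.prems] distinct_card[of w] by auto
    then obtain u a x v where w: "w = u @ a # x @ a # v" and dist: "distinct (a # x)"
      using not_distinct_decomp_innermost by blast
    show ?thesis
    proof (cases "x = []")
      case True
      with w have w': "w = u @ a # a # v"
        by simp
      note rem = pair_word_remove[OF less.prems[unfolded w']]
      let ?n = "card (set (u @ v))"
      have n: "card (set w) = Suc ?n"
        using rem(3) w' by simp
      have "set u \<union> set v - {a} = set (u @ v)"
        using rem(1) by auto
      then have "c\<^sup>2 * card (bad_walks w) \<le> c\<^sup>2 *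
          (K ^ (length u + length v) * c ^ ?n * card {(p, q, r). p \<in> {1..N} \<and> q \<in> {1..N} \<and> r \<in> {1..N}
             \<and> ((p, q), (q, r)) \<in> R \<and> r \<noteq> p} + c * card (bad_walks (u @ v)))"
        using card_bad_walks_backtrack[of u a v] unfolding w' c_def by (intro mult_left_mono) auto
      also have "\<dots> \<le> c\<^sup>2 * (K ^ (length u + length v) * c ^ ?n * D3 + c * card (bad_walks (u @ v)))"
        by (intro mult_left_mono add_right_mono D3) auto
      also have "\<dots> = K ^ (length u + length v) * c ^ Suc ?n * (c * D3)
          + c * (c\<^sup>2 * card (bad_walks (u @ v)))"
        by (simp add: algebra_simps power2_eq_square)
      also have "\<dots> \<le> K ^ length w * c ^ Suc ?n * ?D
          + c * (?n * (K ^ length w * c ^ ?n * ?D))"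
      proof (rule add_mono)
        have K: "K ^ (length u + length v) \<le> K ^ length w"
          using K_pos w' by (intro power_increasing) auto
        then show "K ^ (length u + length v) * c ^ Suc ?n * (c * D3) \<le> K ^ length w * c ^ Suc ?n * ?D"
          by (intro mult_mono) auto
        have "c\<^sup>2 * card (bad_walks (u @ v)) \<le> ?n * (K ^ length (u @ v) * c ^ ?n * ?D)"
          unfolding c_def by (rule less.hyps) (use w' rem(2) in auto)
        also have "\<dots> \<le> ?n * (K ^ length w * c ^ ?n * ?D)"
          using K by (intro mult_left_mono mult_right_mono) auto
        finally show "c * (c\<^sup>2 * card (bad_walks (u @ v))) \<le> c * (?n * (K ^ length w * c ^ ?n * ?D))"
          by (intro mult_left_mono) auto
      qed
      also have "\<dots> = card (set w) * (K ^ length w * c ^ card (set w) * ?D)"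
        unfolding n by (simp add: algebra_simps)
      finally show ?thesis .
    next
      case False
      have "card (bad_walks w) \<le> card (coherent_walks w)"
        by (intro card_mono) (auto simp: bad_walks_def)
      then have "c\<^sup>2 * card (bad_walks w) \<le> c\<^sup>2 * card (coherent_walks w)"
        by (intro mult_left_mono) auto
      also have "\<dots> \<le> K ^ length w * c ^ card (set w) * (N * D1)"
        unfolding c_def by (rule card_coherent_walks_long_loop[OF D1 False dist w])
      also have "\<dots> \<le> 1 * (K ^ length w * c ^ card (set w) * ?D)"
        by simp
      also have "\<dots> \<le> card (set w) * (K ^ length w * c ^ card (set w) * ?D)"
        using \<open>card (set w) > 0\<close> by (intro mult_right_mono) auto
      finally show ?thesis .
    qed
  qed
  then show ?case
    unfolding c_def .
qed

end

section \<open>Expectations along a walk\<close>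

lemma abs_prod_list_le_power:
  fixes xs :: "real list"
  shows "(\<And>x. x \<in> set xs \<Longrightarrow> \<bar>x\<bar> \<le> m) \<Longrightarrow> \<bar>prod_list xs\<bar> \<le> m ^ length xs"
proof (induction xs)
  case (Cons x xs)
  have "\<bar>x\<bar> * \<bar>prod_list xs\<bar> \<le> m * m ^ length xs"
    using Cons.prems[of x] by (intro mult_mono Cons.IH Cons.prems) auto
  then show ?case
    by (simp add: abs_mult)
qed simp

text \<open>An elementary substitute for Hoelder's inequality: the factor of largest absolute value
  dominates the others, and its power is one of the summands. The \<open>1\<close> covers the empty
  product.\<close>

lemma abs_prod_list_le_sum:
  fixes xs :: "real list"
  shows "\<bar>prod_list xs\<bar> \<le> 1 + (\<Sum>x\<leftarrow>xs. \<bar>x\<bar> ^ length xs)"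
proof (cases "xs = []")
  case False
  define m where "m = Max (abs ` set xs)"
  have "m \<in> abs ` set xs"
    unfolding m_def using False by (intro Max_in) auto
  then obtain x where x: "x \<in> set xs" "m = \<bar>x\<bar>"
    by auto
  have "\<bar>prod_list xs\<bar> \<le> m ^ length xs"
    by (rule abs_prod_list_le_power) (auto simp: m_def)
  also have "\<dots> = \<bar>x\<bar> ^ length xs"
    using x by simp
  also have "\<dots> \<le> (\<Sum>x\<leftarrow>xs. \<bar>x\<bar> ^ length xs)"
    by (rule member_le_sum_list) (use x in auto)
  finally show ?thesis
    by simp
qed simp

lemma prod_list_partition:
  fixes f :: "'e \<Rightarrow> 'c :: comm_monoid_mult"
  assumes "finite Q"
  shows "g ` set es \<subseteq> Q \<Longrightarrow> prod_list (map f es) = (\<Prod>c\<in>Q. prod_list (map f (filter (\<lambda>e. g e = c) es)))"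
proof (induction es)
  case (Cons e es)
  have "(\<Prod>c\<in>Q. prod_list (map f (filter (\<lambda>e. g e = c) (e # es))))
      = (\<Prod>c\<in>Q. (if g e = c then f e else 1) * prod_list (map f (filter (\<lambda>e. g e = c) es)))"
    by (intro prod.cong) auto
  also have "\<dots> = f e * prod_list (map f es)"
    using Cons assms by (simp add: prod.distrib)
  finally show ?case
    by simp
qed simp

lemma count_list_map_eq_length_filter:
  "count_list (map g es) c = length (filter (\<lambda>e. g e = c) es)"
  by (induction es) auto

text \<open>Integrability of the moments is assumed separately because the integral of a
  non-integrable function is 0 by convention, so a bound on expectations would not express finite
  moments. For independence, the family over a class is one random element of a product
  space.\<close>

locale band_ensemble = index_relation N b K R + prob_space M
  for N b K R and M :: "'a measure" +
  fixes X :: "nat \<Rightarrow> nat \<Rightarrow> 'a \<Rightarrow> real"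
  assumes X_meas: "i \<in> {1..N} \<Longrightarrow> j \<in> {1..N} \<Longrightarrow> X i j \<in> borel_measurable M"
    and X_sym: "i \<in> {1..N} \<Longrightarrow> j \<in> {1..N} \<Longrightarrow> X i j = X j i"
    and X_mean: "i \<in> {1..N} \<Longrightarrow> j \<in> {1..N} \<Longrightarrow> expectation (X i j) = 0"
    and X_var: "i \<in> {1..N} \<Longrightarrow> j \<in> {1..N} \<Longrightarrow> expectation (\<lambda>\<omega>. (X i j \<omega>)\<^sup>2) = 1"
    and X_int: "i \<in> {1..N} \<Longrightarrow> j \<in> {1..N} \<Longrightarrow> integrable M (\<lambda>\<omega>. \<bar>X i j \<omega>\<bar> ^ m)"
    and X_indep: "indep_vars (\<lambda>C. PiM C (\<lambda>_. borel)) (\<lambda>C \<omega>. restrict (\<lambda>(p, q). X p q \<omega>) C)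
                    (({1..N} \<times> {1..N}) // R)"
begin

abbreviation "pairs \<equiv> {1..N} \<times> {1..N}"

definition edge_prod :: "(nat \<times> nat) list \<Rightarrow> 'a \<Rightarrow> real" where
  "edge_prod es \<omega> = prod_list (map (\<lambda>(i, j). X i j \<omega>) es)"

lemma edge_prod_Nil: "edge_prod [] = (\<lambda>\<omega>. 1)"
  by (simp add: edge_prod_def fun_eq_iff)

lemma edge_prod_Cons: "edge_prod ((i, j) # es) = (\<lambda>\<omega>. X i j \<omega> * edge_prod es \<omega>)"
  by (simp add: edge_prod_def fun_eq_iff)

definition class_of :: "nat \<times> nat \<Rightarrow> (nat \<times> nat) set" where
  "class_of e = R `` {e}"

lemma class_of_eq_iff: "e \<in> pairs \<Longrightarrow> e' \<in> pairs \<Longrightarrow> class_of e = class_of e' \<longleftrightarrow> (e, e') \<in> R"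
  unfolding class_of_def using eq_equiv_class_iff[OF equiv] by blast

lemma edge_prod_measurable [measurable]:
  "set es \<subseteq> pairs \<Longrightarrow> edge_prod es \<in> borel_measurable M"
proof (induction es)
  case (Cons e es)
  then show ?case
    using X_meas by (cases e) (auto simp: edge_prod_Cons)
qed (simp add: edge_prod_Nil)

lemma abs_edge_prod_le:
  "\<bar>edge_prod es \<omega>\<bar> \<le> 1 + (\<Sum>(i, j)\<leftarrow>es. \<bar>X i j \<omega>\<bar> ^ length es)"
  using abs_prod_list_le_sum[of "map (\<lambda>(i, j). X i j \<omega>) es"]
  by (simp add: edge_prod_def comp_def case_prod_unfold)

lemma integrable_sum_moments:
  "set es \<subseteq> pairs \<Longrightarrow> integrable M (\<lambda>\<omega>. \<Sum>(i, j)\<leftarrow>es. \<bar>X i j \<omega>\<bar> ^ m)"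
proof (induction es)
  case (Cons e es)
  then show ?case
    using X_int by (cases e) auto
qed simp

lemma expectation_sum_moments_le:
  assumes "\<And>i j. i \<in> {1..N} \<Longrightarrow> j \<in> {1..N} \<Longrightarrow> expectation (\<lambda>\<omega>. \<bar>X i j \<omega>\<bar> ^ m) \<le> C"
  shows "set es \<subseteq> pairs \<Longrightarrow>
    expectation (\<lambda>\<omega>. \<Sum>(i, j)\<leftarrow>es. \<bar>X i j \<omega>\<bar> ^ m) \<le> real (length es) * C"
proof (induction es)
  case (Cons e es)
  obtain i j where e: "e = (i, j)" "i \<in> {1..N}" "j \<in> {1..N}"
    using Cons.prems by auto
  have "expectation (\<lambda>\<omega>. \<Sum>(i, j)\<leftarrow>e # es. \<bar>X i j \<omega>\<bar> ^ m)
      = expectation (\<lambda>\<omega>. \<bar>X i j \<omega>\<bar> ^ m) + expectation (\<lambda>\<omega>. \<Sum>(i, j)\<leftarrow>es. \<bar>X i j \<omega>\<bar> ^ m)"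
    using Cons.prems X_int[OF e(2,3)] integrable_sum_moments[of es] by (simp add: e(1))
  also have "\<dots> \<le> C + real (length es) * C"
    using Cons assms[OF e(2,3)] by (intro add_mono) auto
  finally show ?case
    by (simp add: algebra_simps)
qed simp

lemma edge_prod_integrable:
  assumes "set es \<subseteq> pairs"
  shows "integrable M (edge_prod es)"
proof (rule Bochner_Integration.integrable_bound)
  show "integrable M (\<lambda>\<omega>. 1 + (\<Sum>(i, j)\<leftarrow>es. \<bar>X i j \<omega>\<bar> ^ length es))"
    using integrable_sum_moments[OF assms] by simp
  show "AE \<omega> in M. norm (edge_prod es \<omega>) \<le> norm (1 + (\<Sum>(i, j)\<leftarrow>es. \<bar>X i j \<omega>\<bar> ^ length es))"
    by (intro AE_I2) (use abs_edge_prod_le in \<open>auto intro: order_trans[OF _ abs_ge_self]\<close>)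
qed (use assms in measurable)

lemma abs_expectation_edge_prod_le:
  assumes "\<And>i j. i \<in> {1..N} \<Longrightarrow> j \<in> {1..N} \<Longrightarrow> expectation (\<lambda>\<omega>. \<bar>X i j \<omega>\<bar> ^ length es) \<le> C"
    and es: "set es \<subseteq> pairs"
  shows "\<bar>expectation (edge_prod es)\<bar> \<le> 1 + real (length es) * C"
proof -
  have "\<bar>expectation (edge_prod es)\<bar> \<le> expectation (\<lambda>\<omega>. \<bar>edge_prod es \<omega>\<bar>)"
    using integral_abs_bound by blast
  also have "\<dots> \<le> expectation (\<lambda>\<omega>. 1 + (\<Sum>(i, j)\<leftarrow>es. \<bar>X i j \<omega>\<bar> ^ length es))"
    using abs_edge_prod_le edge_prod_integrable[OF es] integrable_sum_moments[OF es]
    by (intro integral_mono) auto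
  also have "\<dots> = 1 + expectation (\<lambda>\<omega>. \<Sum>(i, j)\<leftarrow>es. \<bar>X i j \<omega>\<bar> ^ length es)"
    using integrable_sum_moments[OF es] by (simp add: prob_space)
  also have "\<dots> \<le> 1 + real (length es) * C"
    using expectation_sum_moments_le[OF assms(1) es] by simp
  finally show ?thesis .
qed

text \<open>Edges are grouped by class. The product over a group is a measurable function of the
  family of that class, so independence applies; classes that do not occur contribute the empty
  product.\<close>

lemma expectation_edge_prod:
  assumes es: "set es \<subseteq> pairs"
  shows "expectation (edge_prod es)
     = (\<Prod>c\<in>pairs // R. expectation (edge_prod (filter (\<lambda>e. class_of e = c) es)))"
proof -
  let ?Q = "pairs // R"
  let ?f = "\<lambda>c. filter (\<lambda>e. class_of e = c) es"
  have fin: "finite ?Q"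
    using equiv by (intro finite_quotient) (auto simp: equiv_def refl_on_def)
  have in_c: "set (?f c) \<subseteq> c" for c
    using es equiv_class_self[OF equiv] by (auto simp: class_of_def)
  have meas: "set l \<subseteq> c \<Longrightarrow> (\<lambda>y. prod_list (map y l)) \<in> borel_measurable (PiM c (\<lambda>_. borel :: real measure))"
    for l :: "(nat \<times> nat) list" and c
  proof (induction l)
    case (Cons e l)
    then have "(\<lambda>y. y e) \<in> borel_measurable (PiM c (\<lambda>_. borel :: real measure))"
      by (intro measurable_component_singleton) simp
    with Cons show ?case
      by simp
  qed simp
  have "indep_vars (\<lambda>_. borel)
      (\<lambda>c \<omega>. prod_list (map (restrict (\<lambda>(p, q). X p q \<omega>) c) (?f c))) ?Q"
    by (rule indep_vars_compose2[OF X_indep]) (rule meas[OF in_c])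
  also have "(\<lambda>c \<omega>. prod_list (map (restrict (\<lambda>(p, q). X p q \<omega>) c) (?f c))) = (\<lambda>c. edge_prod (?f c))"
  proof (intro ext)
    fix c \<omega>
    have "map (restrict (\<lambda>(p, q). X p q \<omega>) c) (?f c) = map (\<lambda>(p, q). X p q \<omega>) (?f c)"
      using in_c by (intro map_cong) auto
    then show "prod_list (map (restrict (\<lambda>(p, q). X p q \<omega>) c) (?f c)) = edge_prod (?f c) \<omega>"
      by (simp only: edge_prod_def)
  qed
  finally have indep: "indep_vars (\<lambda>_. borel) (\<lambda>c. edge_prod (?f c)) ?Q" .
  have "class_of ` set es \<subseteq> ?Q"
    using es by (auto simp: class_of_def intro: quotientI)
  then have "edge_prod es \<omega> = (\<Prod>c\<in>?Q. edge_prod (?f c) \<omega>)" for \<omega>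
    unfolding edge_prod_def by (rule prod_list_partition[OF fin])
  then have "expectation (edge_prod es) = expectation (\<lambda>\<omega>. \<Prod>c\<in>?Q. edge_prod (?f c) \<omega>)"
    by presburger
  also have "\<dots> = (\<Prod>c\<in>?Q. expectation (edge_prod (?f c)))"
    by (rule indep_vars_lebesgue_integral[OF fin indep]) (use es in \<open>auto intro!: edge_prod_integrable\<close>)
  finally show ?thesis .
qed

section \<open>Walks with an isolated class and reflecting walks\<close>

definition class_word :: "nat list \<Rightarrow> (nat \<times> nat) set list" where
  "class_word p = map class_of (edges p)"

lemma set_edges_walk: "p \<in> walks N b k \<Longrightarrow> set (edges p) \<subseteq> pairs"
  using set_edges_subset[of p] by (auto simp: walks_def)

lemma length_class_word: "p \<in> walks N b k \<Longrightarrow> length (class_word p) = k"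
  by (simp add: class_word_def walks_def)

lemma reflecting_parse_class_word:
  assumes "p \<in> walks N b k" "reflecting d p"
  shows "parse [] d (class_word p)"
proof -
  \<comment> \<open>Ordering the end points picks an orientation of the undirected edge. As
    \<open>\<sim>\<close> ignores orientation, its class is that of the edge, so the parse of
    undirected edges transfers to classes by \<open>parse_map\<close>.\<close>
  define g where "g U = class_of (Min U, Max U)" for U :: "nat set"
  have "class_of e = g (undirected e)" if e: "e \<in> set (edges p)" for e
  proof -
    obtain x y where xy: "e = (x, y)" "x \<in> {1..N}" "y \<in> {1..N}"
      using e set_edges_walk[OF assms(1)] by auto
    have "class_of (x, y) = class_of (y, x)"
      using class_of_eq_iff swap xy by auto
    then show ?thesis
      by (cases "x \<le> y") (auto simp: g_def undirected_def xy(1) max_def min_def)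
  qed
  then have "class_word p = map g (map undirected (edges p))"
    by (simp add: class_word_def)
  then show ?thesis
    using parse_map[of "[]" d "map undirected (edges p)" g] assms(2) by (simp add: reflecting_def)
qed

lemma expectation_singleton:
  assumes p: "p \<in> walks N b k" and c: "count_list (class_word p) c = 1"
  shows "expectation (edge_prod (edges p)) = 0"
proof -
  have es: "set (edges p) \<subseteq> pairs"
    by (rule set_edges_walk[OF p])
  have "length (filter (\<lambda>e. class_of e = c) (edges p)) = Suc 0"
    using c by (simp add: class_word_def count_list_map_eq_length_filter)
  then obtain e where e: "filter (\<lambda>e. class_of e = c) (edges p) = [e]"
    by (auto simp: length_Suc_conv)
  then have "e \<in> set (edges p) \<and> class_of e = c"
    by (metis (mono_tags) filter_eq_ConsD in_set_conv_decomp)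
  then have "e \<in> pairs" and "c = class_of e"
    using es by blast+
  then obtain i j where ij: "e = (i, j)" "i \<in> {1..N}" "j \<in> {1..N}" and c': "c \<in> pairs // R"
    unfolding class_of_def by (blast intro: quotientI)
  have "edge_prod [e] = X i j"
    by (auto simp: edge_prod_def ij(1))
  then have "expectation (edge_prod [e]) = 0"
    using X_mean[OF ij(2,3)] by simp
  moreover have "finite (pairs // R)"
    using equiv by (intro finite_quotient) (auto simp: equiv_def refl_on_def)
  ultimately show ?thesis
    unfolding expectation_edge_prod[OF es] using c' e by (intro prod_zero) (auto intro!: bexI[of _ c])
qed

text \<open>Related edges need not carry equal variables. But each class contains just two edges of
  the walk, and the undirected edge of the first occurs an even number of times, so the second is
  the same edge up to orientation and the class contributes a second moment.\<close>

lemma expectation_reflecting: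
  assumes p: "p \<in> walks N b k" and refl: "reflecting d p" and pair: "pair_word (class_word p)"
  shows "expectation (edge_prod (edges p)) = 1"
proof -
  have es: "set (edges p) \<subseteq> pairs"
    by (rule set_edges_walk[OF p])
  have "expectation (edge_prod (filter (\<lambda>e. class_of e = c) (edges p))) = 1" for c
  proof (cases "c \<in> set (class_word p)")
    case False
    then have "filter (\<lambda>e. class_of e = c) (edges p) = []"
      by (auto simp: filter_empty_conv class_word_def)
    then show ?thesis
      by (simp add: edge_prod_Nil prob_space)
  next
    case True
    then have "length (filter (\<lambda>e. class_of e = c) (edges p)) = Suc (Suc 0)"
      using pair by (simp add: class_word_def count_list_map_eq_length_filter pair_word_def del: set_map)
    then obtain e e' where f: "filter (\<lambda>e. class_of e = c) (edges p) = [e, e']"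
      by (auto simp: length_Suc_conv)
    then have "{e, e'} = {e \<in> set (edges p). class_of e = c}"
      by (metis empty_set list.simps(15) set_filter)
    then have ee: "e \<in> pairs" "e' \<in> pairs" "class_of e = c"
      using es by blast+
    then obtain i j where ij: "e = (i, j)" "i \<in> {1..N}" "j \<in> {1..N}"
      by blast
    have "class_of g = c" if "undirected g = undirected e" for g
    proof -
      have "g = e \<or> g = prod.swap e"
        using that undirected_eq_iff by metis
      moreover have "class_of e = class_of (prod.swap e)"
        using ij swap class_of_eq_iff by simp
      ultimately show ?thesis
        using ee by auto
    qed
    then have "filter (\<lambda>g. undirected g = undirected e) (edges p)
        = filter (\<lambda>g. undirected g = undirected e) (filter (\<lambda>e. class_of e = c) (edges p))"
      unfolding filter_filter by (intro filter_cong) auto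
    then have "count_list (map undirected (edges p)) (undirected e)
        = length (filter (\<lambda>g. undirected g = undirected e) [e, e'])"
      by (simp add: count_list_map_eq_length_filter f)
    moreover have "even (count_list (map undirected (edges p)) (undirected e))"
      using parse_even_count[of "[]" d "map undirected (edges p)" "undirected e"] refl
      by (simp add: reflecting_def)
    ultimately have "undirected e' = undirected e"
      by (auto split: if_splits)
    then have "e' = e \<or> e' = prod.swap e"
      using undirected_eq_iff by metis
    then have "edge_prod [e, e'] \<omega> = (X i j \<omega>)\<^sup>2" for \<omega>
      using X_sym[OF ij(2,3)] ij(1) by (auto simp: edge_prod_def power2_eq_square)
    then have "expectation (edge_prod [e, e']) = expectation (\<lambda>\<omega>. (X i j \<omega>)\<^sup>2)"
      by presburger
    then show ?thesis
      unfolding f using X_var[OF ij(2,3)] by simp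
  qed
  then show ?thesis
    unfolding expectation_edge_prod[OF es] by simp
qed

end

section \<open>The trace as a sum over closed walks\<close>

lemma edges_snoc: "p \<noteq> [] \<Longrightarrow> edges (p @ [x]) = edges p @ [(last p, x)]"
  by (induction p rule: edges.induct) auto

definition paths :: "nat \<Rightarrow> nat \<Rightarrow> nat list set" where
  "paths N k = {p. length p = Suc k \<and> set p \<subseteq> {1..N}}"

lemma finite_paths [simp]: "finite (paths N k)"
  by (rule finite_subset[OF _ finite_lists_length_eq[of "{1..N}" "Suc k"]]) (auto simp: paths_def)

lemma sqmat_pow_eq_sum_paths:
  assumes "i \<in> {1..N}"
  shows "j \<in> {1..N} \<Longrightarrow> sqmat_pow N A k i j
    = (\<Sum>p | p \<in> paths N k \<and> hd p = i \<and> last p = j. prod_list (map (\<lambda>(x, y). A x y) (edges p)))"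
proof (induction k arbitrary: j)
  case 0
  have "{p. p \<in> paths N 0 \<and> hd p = i \<and> last p = j} = (if i = j then {[i]} else {})"
    using assms by (auto simp: paths_def length_Suc_conv)
  then show ?case
    by simp
next
  case (Suc k)
  let ?P = "\<lambda>l. {p. p \<in> paths N k \<and> hd p = i \<and> last p = l}"
  let ?w = "\<lambda>p. prod_list (map (\<lambda>(x, y). A x y) (edges p))"
  have eq: "{p. p \<in> paths N (Suc k) \<and> hd p = i \<and> last p = j} = (\<Union>l\<in>{1..N}. (\<lambda>p. p @ [j]) ` ?P l)"
    (is "?L = ?R")
  proof (intro set_eqI iffI)
    fix p assume p: "p \<in> ?L"
    then have "p \<noteq> []" "length p = Suc (Suc k)"
      by (auto simp: paths_def)
    then obtain q where q: "p = q @ [j]" "length q = Suc k"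
      using p by (cases p rule: rev_cases) auto
    then have "q \<noteq> []"
      by auto
    have "last q \<in> set p"
      using q \<open>q \<noteq> []\<close> by simp
    then have "last q \<in> {1..N}"
      using p unfolding paths_def by blast
    moreover have "q \<in> ?P (last q)"
      using p q \<open>q \<noteq> []\<close> by (auto simp: paths_def)
    ultimately show "p \<in> ?R"
      using q by blast
  next
    fix p assume "p \<in> ?R"
    then obtain q where q: "p = q @ [j]" "q \<in> paths N k" "hd q = i"
      by auto
    then have "q \<noteq> []"
      by (auto simp: paths_def)
    with q Suc.prems show "p \<in> ?L"
      by (auto simp: paths_def)
  qed
  have "(\<Sum>p\<in>?L. ?w p) = (\<Sum>l\<in>{1..N}. \<Sum>p\<in>(\<lambda>p. p @ [j]) ` ?P l. ?w p)"
    unfolding eq by (rule sum.UNION_disjoint) auto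
  also have "\<dots> = (\<Sum>l\<in>{1..N}. \<Sum>p\<in>?P l. ?w p * A l j)"
  proof (rule sum.cong[OF refl])
    fix l
    have "(\<Sum>p\<in>(\<lambda>p. p @ [j]) ` ?P l. ?w p) = (\<Sum>p\<in>?P l. ?w (p @ [j]))"
      by (rule sum.reindex_cong[OF _ refl refl]) (auto simp: inj_on_def)
    also have "\<dots> = (\<Sum>p\<in>?P l. ?w p * A l j)"
    proof (rule sum.cong[OF refl])
      fix p assume p: "p \<in> ?P l"
      then have "p \<noteq> []"
        by (auto simp: paths_def)
      with p show "?w (p @ [j]) = ?w p * A l j"
        by (simp add: edges_snoc)
    qed
    finally show "(\<Sum>p\<in>(\<lambda>p. p @ [j]) ` ?P l. ?w p) = (\<Sum>p\<in>?P l. ?w p * A l j)" .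
  qed
  also have "\<dots> = (\<Sum>l\<in>{1..N}. sqmat_pow N A k i l * A l j)"
    by (intro sum.cong refl) (simp add: Suc.IH sum_distrib_right)
  finally show ?case
    by (simp add: sqmat_mult_def)
qed

lemma sqmat_trace_pow_eq_sum_paths:
  "sqmat_trace N (sqmat_pow N A k)
    = (\<Sum>p | p \<in> paths N k \<and> last p = hd p. prod_list (map (\<lambda>(x, y). A x y) (edges p)))"
proof -
  let ?P = "\<lambda>i. {p. p \<in> paths N k \<and> hd p = i \<and> last p = i}"
  let ?w = "\<lambda>p. prod_list (map (\<lambda>(x, y). A x y) (edges p))"
  have "sqmat_trace N (sqmat_pow N A k) = (\<Sum>i\<in>{1..N}. \<Sum>p\<in>?P i. ?w p)"
    unfolding sqmat_trace_def by (intro sum.cong refl sqmat_pow_eq_sum_paths)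
  also have "\<dots> = (\<Sum>p\<in>(\<Union>i\<in>{1..N}. ?P i). ?w p)"
    by (rule sum.UNION_disjoint[symmetric]) auto
  also have "(\<Union>i\<in>{1..N}. ?P i) = {p. p \<in> paths N k \<and> last p = hd p}"
  proof -
    have "hd p \<in> {1..N}" if "p \<in> paths N k" for p
      using that by (cases p) (auto simp: paths_def)
    then show ?thesis
      by auto
  qed
  finally show ?thesis .
qed

definition closed_walks :: "nat \<Rightarrow> nat \<Rightarrow> nat \<Rightarrow> nat list set" where
  "closed_walks N b k = {p \<in> walks N b k. last p = hd p}"

lemma finite_closed_walks [simp]: "finite (closed_walks N b k)"
  by (simp add: closed_walks_def)

lemma sqmat_trace_pow_band_matrix:
  "sqmat_trace N (sqmat_pow N (band_matrix b Y) k)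
     = (\<Sum>p\<in>closed_walks N b k. prod_list (map (\<lambda>(x, y). Y x y) (edges p))) / sqrt (2 * real b) ^ k"
proof -
  let ?A = "band_matrix b Y"
  let ?w = "\<lambda>A p. prod_list (map (\<lambda>(x, y). A x y :: real) (edges p))"
  have A: "?A x y = (if near b (x, y) then Y x y else 0) / sqrt (2 * real b)" for x y
    by (simp add: band_matrix_def near_def)
  have "(\<Sum>p | p \<in> paths N k \<and> last p = hd p. ?w ?A p) = (\<Sum>p\<in>closed_walks N b k. ?w ?A p)"
  proof (rule sum.mono_neutral_right)
    show "\<forall>p\<in>{p. p \<in> paths N k \<and> last p = hd p} - closed_walks N b k. ?w ?A p = 0"
    proof
      fix p assume "p \<in> {p. p \<in> paths N k \<and> last p = hd p} - closed_walks N b k"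
      then obtain x y where "(x, y) \<in> set (edges p)" "\<not> near b (x, y)"
        by (auto simp: closed_walks_def walks_def paths_def)
      then have "0 \<in> set (map (\<lambda>(x, y). ?A x y) (edges p))"
        by (force simp: A)
      then show "?w ?A p = 0"
        by (simp add: prod_list_zero_iff)
    qed
    show "finite {p. p \<in> paths N k \<and> last p = hd p}"
      by (rule finite_subset[OF _ finite_paths]) auto
  qed (auto simp: closed_walks_def walks_def paths_def)
  also have "\<dots> = (\<Sum>p\<in>closed_walks N b k. ?w Y p / sqrt (2 * real b) ^ k)"
  proof (rule sum.cong[OF refl])
    fix p assume p: "p \<in> closed_walks N b k"
    have "(\<forall>e\<in>set es. near b e) \<Longrightarrow> prod_list (map (\<lambda>(x, y). ?A x y) es)
        = prod_list (map (\<lambda>(x, y). Y x y) es) / sqrt (2 * real b) ^ length es" for es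
      by (induction es) (auto simp: A)
    then show "?w ?A p = ?w Y p / sqrt (2 * real b) ^ k"
      using p by (simp add: closed_walks_def walks_def)
  qed
  finally show ?thesis
    by (simp add: sqmat_trace_pow_eq_sum_paths sum_divide_distrib)
qed

lemma (in band_ensemble) expectation_trace:
  "expectation (\<lambda>\<omega>. sqmat_trace N (sqmat_pow N (band_matrix b (\<lambda>i j. X i j \<omega>)) k))
     = (\<Sum>p\<in>closed_walks N b k. expectation (edge_prod (edges p))) / sqrt (2 * real b) ^ k"
proof -
  have "integrable M (edge_prod (edges p))" if "p \<in> closed_walks N b k" for p
    using that set_edges_walk by (intro edge_prod_integrable) (auto simp: closed_walks_def)
  then show ?thesis
    unfolding sqmat_trace_pow_band_matrix edge_prod_def[symmetric] by simp
qed

section \<open>Exceptional walks and the reduction to Dyck words\<close>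

definition words :: "nat \<Rightarrow> nat list set" where
  "words k = {w. set w \<subseteq> {..<k} \<and> length w = k}"

lemma finite_words [simp]: "finite (words k)"
  unfolding words_def by (rule finite_lists_length_eq) simp

text \<open>\<open>k\<close> labels suffice for the classes of \<open>k\<close> edges, so the number
  of label words does not depend on \<open>N\<close>.\<close>

lemma card_words: "card (words k) = k ^ k"
  unfolding words_def by (subst card_lists_length_eq) auto

context band_ensemble
begin

definition degenerate_walks :: "nat \<Rightarrow> nat list set" where
  "degenerate_walks k = (\<Union>w\<in>{w\<in>words k. 2 * card (set w) < k}. coherent_walks w)"

definition crossing_walks :: "nat \<Rightarrow> nat list set" where
  "crossing_walks k = (\<Union>w\<in>{w\<in>words k. pair_word w}. bad_walks w)"

lemma finite_degenerate_walks [simp]: "finite (degenerate_walks k)"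
  by (simp add: degenerate_walks_def)

lemma finite_crossing_walks [simp]: "finite (crossing_walks k)"
  by (simp add: crossing_walks_def)

text \<open>The classes met by the walk are renamed injectively by numbers below \<open>k\<close>;
  injectivity preserves multiplicities and yields coherence.\<close>

lemma exists_label_word:
  assumes p: "p \<in> walks N b k"
  shows "\<exists>w\<in>words k. p \<in> coherent_walks w \<and> card (set w) = card (set (class_word p))
           \<and> (pair_word (class_word p) \<longrightarrow> pair_word w)"
proof -
  have "card (set (class_word p)) \<le> card {..<k}"
    using card_length[of "class_word p"] length_class_word[OF p] by simp
  then obtain f where f: "f ` set (class_word p) \<subseteq> {..<k}" "inj_on f (set (class_word p))"
    using card_le_inj[of "set (class_word p)" "{..<k}"] by auto
  define w where "w = map f (class_word p)"
  have "w \<in> words k"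
    using f(1) length_class_word[OF p] by (simp add: words_def w_def)
  moreover have "card (set w) = card (set (class_word p))"
    using f(2) by (simp add: w_def card_image)
  moreover have "pair_word w" if "pair_word (class_word p)"
    using that f(2) by (auto simp: pair_word_def w_def count_list_inj_map)
  moreover have "coherent R (edges p) w"
  proof -
    have "set (zip (edges p) w) = (\<lambda>e. (e, f (class_of e))) ` set (edges p)"
      by (simp add: w_def class_word_def zip_map2 zip_same_conv_map image_image)
    moreover have "(e, e') \<in> R"
      if e: "e \<in> set (edges p)" "e' \<in> set (edges p)" and "f (class_of e) = f (class_of e')" for e e'
    proof -
      have "class_of e = class_of e'"
        using that by (intro inj_onD[OF f(2)]) (auto simp: class_word_def)
      then show ?thesis
        using set_edges_walk[OF p] e class_of_eq_iff by blast
    qed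
    ultimately show ?thesis
      unfolding coherent_def by (simp only: Set.ball_simps(9) prod.case) blast
  qed
  moreover have "length w = k"
    using \<open>w \<in> words k\<close> by (simp add: words_def)
  ultimately show ?thesis
    using p unfolding coherent_walks_def by (intro bexI[of _ w]) simp_all
qed

text \<open>If some class occurs once, the expectation vanishes and parity excludes every Dyck word.
  Otherwise both sides are 1: non-degeneracy makes every class occur exactly twice, the exclusion of
  crossing walks supplies a Dyck word, and \<open>parse_unique\<close> makes it the only
  one.\<close>

lemma expectation_eq_card_reflecting:
  assumes p: "p \<in> walks N b k" and nd: "p \<notin> degenerate_walks k" and nc: "p \<notin> crossing_walks k"
  shows "expectation (edge_prod (edges p)) = real (card {d \<in> dyck_words k 0. reflecting d p})"
proof -
  let ?w = "class_word p"
  obtain w where w: "w \<in> words k" "p \<in> coherent_walks w" "card (set w) = card (set ?w)"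
    "pair_word ?w \<Longrightarrow> pair_word w"
    using exists_label_word[OF p] by blast
  show ?thesis
  proof (cases "\<exists>c. count_list ?w c = 1")
    case True
    then obtain c where c: "count_list ?w c = 1" ..
    have "\<not> reflecting d p" for d
    proof
      assume "reflecting d p"
      then have "even (count_list ?w c)"
        using parse_even_count[of "[]" d ?w c] reflecting_parse_class_word[OF p] by simp
      then show False
        using c by simp
    qed
    then show ?thesis
      using expectation_singleton[OF p c] by simp
  next
    case False
    have ge2: "count_list ?w c \<ge> 2" if "c \<in> set ?w" for c
    proof -
      have "count_list ?w c \<noteq> 0"
        unfolding count_list_0_iff using that by blast
      moreover have "count_list ?w c \<noteq> 1"
        using False by blast
      ultimately show ?thesis
        by linarith
    qed
    have "\<not> 2 * card (set ?w) < k"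
    proof
      assume "2 * card (set ?w) < k"
      with w(1,3) have "w \<in> {w \<in> words k. 2 * card (set w) < k}"
        by simp
      with w(2) nd show False
        unfolding degenerate_walks_def by blast
    qed
    \<comment> \<open>The counts add up to \<open>k\<close>, which is at most twice the number of
      classes; as each is at least 2, none can exceed 2.\<close>
    then have le: "(\<Sum>c\<in>set ?w. count_list ?w c) \<le> (\<Sum>c\<in>set ?w. 2)"
      using sum_count_set[of ?w "set ?w"] length_class_word[OF p] by simp
    have pair: "pair_word ?w"
      unfolding pair_word_def
    proof (rule ccontr)
      assume "\<not> (\<forall>a\<in>set ?w. count_list ?w a = 2)"
      then obtain a where a: "a \<in> set ?w" "count_list ?w a \<noteq> 2"
        by blast
      with ge2[OF a(1)] have "2 < count_list ?w a"
        by linarith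
      then have "\<exists>a\<in>set ?w. 2 < count_list ?w a"
        using a(1) by blast
      then have "(\<Sum>c\<in>set ?w. 2) < (\<Sum>c\<in>set ?w. count_list ?w c)"
        using ge2 by (intro sum_strict_mono_ex1 ballI) simp_all
      with le show False
        by simp
    qed
    have "p \<notin> bad_walks w"
      using nc w(1) w(4)[OF pair] unfolding crossing_walks_def by blast
    then obtain d where d: "reflecting d p"
      using w(2) by (auto simp: bad_walks_def)
    have "d' = d" if "reflecting d' p" for d'
    proof (rule parse_unique)
      show "parse [] d' ?w" "parse [] d ?w"
        using that d by (simp_all add: reflecting_parse_class_word[OF p])
      show "count_list ?w a + count_list [] a \<le> 2" for a
        using pair by (cases "a \<in> set ?w") (simp_all add: pair_word_def)
    qed
    moreover have "d \<in> dyck_words k 0"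
      using reflecting_dyck[OF d] p by (simp add: walks_def)
    ultimately have "{d \<in> dyck_words k 0. reflecting d p} = {d}"
      using d by blast
    then show ?thesis
      using expectation_reflecting[OF p d pair] by simp
  qed
qed

text \<open>Double counting of pairs of a Dyck word and a walk; by \<open>reflecting_closed\<close>
  the restriction to closed walks loses nothing.\<close>

lemma sum_card_reflecting_walks:
  "(\<Sum>d\<in>dyck_words k 0. card (reflecting_walks N b d))
     = (\<Sum>p\<in>closed_walks N b k. card {d \<in> dyck_words k 0. reflecting d p})"
proof -
  have "(\<Sum>d\<in>dyck_words k 0. card (reflecting_walks N b d))
      = (\<Sum>d\<in>dyck_words k 0. \<Sum>p\<in>closed_walks N b k. if reflecting d p then 1 else 0)"
  proof (rule sum.cong[OF refl])
    fix d assume "d \<in> dyck_words k 0"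
    then have "reflecting_walks N b d = {p \<in> closed_walks N b k. reflecting d p}"
      using reflecting_closed by (auto simp: reflecting_walks_def closed_walks_def dyck_words_def)
    then show "card (reflecting_walks N b d)
        = (\<Sum>p\<in>closed_walks N b k. if reflecting d p then 1 else 0)"
      by (simp add: sum.If_cases Int_def)
  qed
  also have "\<dots> = (\<Sum>p\<in>closed_walks N b k. \<Sum>d\<in>dyck_words k 0. if reflecting d p then 1 else 0)"
    by (rule sum.swap)
  also have "\<dots> = (\<Sum>p\<in>closed_walks N b k. card {d \<in> dyck_words k 0. reflecting d p})"
    by (intro sum.cong refl) (simp add: sum.If_cases Int_def)
  finally show ?thesis .
qed

text \<open>The terms cancel off the exceptional sets. On them cancellation is given up, and each
  term is bounded by the moments and the total number of Dyck words.\<close>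

lemma abs_sum_expectation_diff_le:
  assumes C: "\<And>i j. i \<in> {1..N} \<Longrightarrow> j \<in> {1..N} \<Longrightarrow> expectation (\<lambda>\<omega>. \<bar>X i j \<omega>\<bar> ^ k) \<le> C"
    and "0 \<le> C"
  shows "\<bar>(\<Sum>p\<in>closed_walks N b k. expectation (edge_prod (edges p)))
            - real (\<Sum>d\<in>dyck_words k 0. card (reflecting_walks N b d))\<bar>
       \<le> (1 + real k * C + real (card (dyck_words k 0)))
            * real (card (degenerate_walks k) + card (crossing_walks k))"
proof -
  let ?E = "\<lambda>p. expectation (edge_prod (edges p))"
  let ?n = "\<lambda>p. real (card {d \<in> dyck_words k 0. reflecting d p})"
  let ?B = "degenerate_walks k \<union> crossing_walks k"
  let ?c = "1 + real k * C + real (card (dyck_words k 0))"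
  have bound: "\<bar>?E p - ?n p\<bar> \<le> ?c" if "p \<in> closed_walks N b k" for p
  proof -
    have p: "p \<in> walks N b k" "length (edges p) = k"
      using that by (auto simp: closed_walks_def walks_def)
    have "\<bar>?E p\<bar> \<le> 1 + real k * C"
      using abs_expectation_edge_prod_le[of "edges p" C] C set_edges_walk[OF p(1)] p(2) by simp
    moreover have "?n p \<le> real (card (dyck_words k 0))"
      by (simp add: card_mono)
    ultimately show ?thesis
      by (simp add: abs_le_iff)
  qed
  have "(\<Sum>p\<in>closed_walks N b k. ?E p) - real (\<Sum>d\<in>dyck_words k 0. card (reflecting_walks N b d))
      = (\<Sum>p\<in>closed_walks N b k. ?E p - ?n p)"
    by (simp add: sum_card_reflecting_walks sum_subtractf)
  also have "\<dots> = (\<Sum>p\<in>closed_walks N b k \<inter> ?B. ?E p - ?n p)"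
  proof (rule sum.mono_neutral_right)
    show "\<forall>p\<in>closed_walks N b k - closed_walks N b k \<inter> ?B. ?E p - ?n p = 0"
    proof
      fix p assume "p \<in> closed_walks N b k - closed_walks N b k \<inter> ?B"
      then show "?E p - ?n p = 0"
        using expectation_eq_card_reflecting[of p k] by (simp add: closed_walks_def)
    qed
  qed auto
  finally have "\<bar>(\<Sum>p\<in>closed_walks N b k. ?E p) - real (\<Sum>d\<in>dyck_words k 0. card (reflecting_walks N b d))\<bar>
      \<le> (\<Sum>p\<in>closed_walks N b k \<inter> ?B. \<bar>?E p - ?n p\<bar>)"
    by (simp only: sum_abs)
  also have "\<dots> \<le> (\<Sum>p\<in>closed_walks N b k \<inter> ?B. ?c)"
    by (intro sum_mono bound) simp
  also have "\<dots> = ?c * real (card (closed_walks N b k \<inter> ?B))"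
    by simp
  also have "\<dots> \<le> ?c * real (card (degenerate_walks k) + card (crossing_walks k))"
  proof (rule mult_left_mono)
    have "card (closed_walks N b k \<inter> ?B) \<le> card (degenerate_walks k) + card (crossing_walks k)"
      by (rule order_trans[OF card_mono card_Un_le]) auto
    then show "real (card (closed_walks N b k \<inter> ?B)) \<le> real (card (degenerate_walks k) + card (crossing_walks k))"
      by linarith
  qed (use \<open>0 \<le> C\<close> in simp)
  finally show ?thesis .
qed

text \<open>If the number \<open>m\<close> of letters satisfies \<open>2 * m < k\<close>, then
  \<open>(2b+1)^m\<close> is at most \<open>sqrt (2b+1)^(k-1)\<close>. The square root treats both
  parities of \<open>k\<close> at once.\<close>

lemma card_degenerate_walks_le:
  "real (card (degenerate_walks k)) * sqrt (2 * real b + 1)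
     \<le> real k ^ k * real K ^ k * sqrt (2 * real b + 1) ^ k * real N"
proof -
  let ?c = "2 * real b + 1"
  let ?W = "{w \<in> words k. 2 * card (set w) < k}"
  have "real (card (coherent_walks w)) * sqrt ?c \<le> real K ^ k * sqrt ?c ^ k * real N" if w: "w \<in> ?W" for w
  proof -
    have "real (card (coherent_walks w)) \<le> real (K ^ length w * (2 * b + 1) ^ card (set w) * N)"
      using card_coherent_walks_le of_nat_le_iff by blast
    also have "\<dots> = real K ^ k * sqrt ?c ^ (2 * card (set w)) * real N"
      using w by (simp add: words_def power_mult add.commute)
    finally have "real (card (coherent_walks w)) * sqrt ?c
        \<le> real K ^ k * sqrt ?c ^ (2 * card (set w)) * real N * sqrt ?c"
      by (rule mult_right_mono) simp
    also have "\<dots> = real K ^ k * sqrt ?c ^ Suc (2 * card (set w)) * real N"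
      by (simp add: mult_ac)
    also have "\<dots> \<le> real K ^ k * sqrt ?c ^ k * real N"
      using w by (intro mult_right_mono mult_left_mono power_increasing) auto
    finally show ?thesis .
  qed
  note each = this
  have "real (card (degenerate_walks k)) \<le> (\<Sum>w\<in>?W. real (card (coherent_walks w)))"
    unfolding degenerate_walks_def of_nat_sum[symmetric] of_nat_le_iff by (rule card_UN_le) simp
  then have "real (card (degenerate_walks k)) * sqrt ?c \<le> (\<Sum>w\<in>?W. real (card (coherent_walks w))) * sqrt ?c"
    by (rule mult_right_mono) simp
  also have "\<dots> = (\<Sum>w\<in>?W. real (card (coherent_walks w)) * sqrt ?c)"
    by (rule sum_distrib_right)
  also have "\<dots> \<le> (\<Sum>w\<in>?W. real K ^ k * sqrt ?c ^ k * real N)"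
    by (intro sum_mono each)
  also have "\<dots> \<le> (\<Sum>w\<in>words k. real K ^ k * sqrt ?c ^ k * real N)"
    by (rule sum_mono2) auto
  finally show ?thesis
    by (simp add: card_words mult_ac)
qed

lemma card_crossing_walks_le:
  assumes D1: "\<And>p. p \<in> {1..N} \<Longrightarrow> card {(q, r, s). q \<in> {1..N} \<and> r \<in> {1..N} \<and> s \<in> {1..N}
                                   \<and> ((p, q), (r, s)) \<in> R} \<le> D1"
    and D3: "card {(p, q, r). p \<in> {1..N} \<and> q \<in> {1..N} \<and> r \<in> {1..N}
                                   \<and> ((p, q), (q, r)) \<in> R \<and> r \<noteq> p} \<le> D3"
  shows "(2 * real b + 1)\<^sup>2 * real (card (crossing_walks k))
     \<le> real k ^ k * (real k * real K ^ k * sqrt (2 * real b + 1) ^ k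
          * ((2 * real b + 1) * real D3 + real N * real D1))"
proof -
  let ?c = "2 * real b + 1"
  let ?W = "{w \<in> words k. pair_word w}"
  let ?D = "?c * real D3 + real N * real D1"
  have each: "?c\<^sup>2 * real (card (bad_walks w)) \<le> real k * real K ^ k * sqrt ?c ^ k * ?D" if w: "w \<in> ?W" for w
  proof -
    have k: "k = 2 * card (set w)" and lw: "length w = k"
      using w pair_word_length[of w] by (auto simp: words_def)
    have "?c\<^sup>2 * real (card (bad_walks w)) = real ((2 * b + 1)\<^sup>2 * card (bad_walks w))"
      by simp
    also have "\<dots> \<le> real (card (set w) * (K ^ length w * (2 * b + 1) ^ card (set w) * ((2 * b + 1) * D3 + N * D1)))"
      unfolding of_nat_le_iff by (rule card_bad_walks_le[OF D1 D3]) (use w in auto)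
    also have "\<dots> = real (card (set w)) * (real K ^ k * ?c ^ card (set w) * ?D)"
      unfolding lw by (simp add: algebra_simps)
    also have "?c ^ card (set w) = sqrt ?c ^ k"
      by (subst k) (simp add: power_mult)
    also have "real (card (set w)) * (real K ^ k * sqrt ?c ^ k * ?D) \<le> real k * (real K ^ k * sqrt ?c ^ k * ?D)"
      using k by (intro mult_right_mono) auto
    finally show ?thesis
      by (simp add: mult_ac)
  qed
  have "real (card (crossing_walks k)) \<le> (\<Sum>w\<in>?W. real (card (bad_walks w)))"
    unfolding crossing_walks_def of_nat_sum[symmetric] of_nat_le_iff by (rule card_UN_le) simp
  then have "?c\<^sup>2 * real (card (crossing_walks k)) \<le> ?c\<^sup>2 * (\<Sum>w\<in>?W. real (card (bad_walks w)))"
    by (rule mult_left_mono) simp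
  also have "\<dots> = (\<Sum>w\<in>?W. ?c\<^sup>2 * real (card (bad_walks w)))"
    by (rule sum_distrib_left)
  also have "\<dots> \<le> (\<Sum>w\<in>?W. real k * real K ^ k * sqrt ?c ^ k * ?D)"
    by (intro sum_mono each)
  also have "\<dots> \<le> (\<Sum>w\<in>words k. real k * real K ^ k * sqrt ?c ^ k * ?D)"
    by (rule sum_mono2) auto
  finally show ?thesis
    by (simp add: card_words)
qed

end

section \<open>The limit\<close>

text \<open>The relative errors are \<open>1 / sqrt c\<close> from degenerate walks and the two
  terms with \<open>D3\<close> and \<open>D1\<close> from crossing ones. The ratio of square roots
  compares the bound \<open>2 * b + 1\<close> on neighbours with the normalisation by
  \<open>2 * b\<close>.\<close>

lemma (in band_ensemble) abs_trace_diff_le: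
  assumes "N > 0" "b > 0"
    and C: "\<And>i j. i \<in> {1..N} \<Longrightarrow> j \<in> {1..N} \<Longrightarrow> expectation (\<lambda>\<omega>. \<bar>X i j \<omega>\<bar> ^ k) \<le> C" "0 \<le> C"
    and D1: "\<And>p. p \<in> {1..N} \<Longrightarrow> card {(q, r, s). q \<in> {1..N} \<and> r \<in> {1..N} \<and> s \<in> {1..N}
                                   \<and> ((p, q), (r, s)) \<in> R} \<le> D1"
    and D3: "card {(p, q, r). p \<in> {1..N} \<and> q \<in> {1..N} \<and> r \<in> {1..N}
                                   \<and> ((p, q), (q, r)) \<in> R \<and> r \<noteq> p} \<le> D3"
  defines "c \<equiv> 2 * real b + 1"
  shows "\<bar>expectation (\<lambda>\<omega>. sqmat_trace N (sqmat_pow N (band_matrix b (\<lambda>i j. X i j \<omega>)) k)) / real N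
            - real (\<Sum>d\<in>dyck_words k 0. card (reflecting_walks N b d)) / (real N * sqrt (2 * real b) ^ k)\<bar>
       \<le> (1 + real k * C + real (card (dyck_words k 0))) * (real k ^ k * real K ^ k)
           * ((sqrt c / sqrt (2 * real b)) ^ k
              * (1 / sqrt c + real k * (real D3 / (real N * c) + real D1 / c\<^sup>2)))"
proof -
  let ?S = "\<Sum>p\<in>closed_walks N b k. expectation (edge_prod (edges p))"
  let ?G = "real (\<Sum>d\<in>dyck_words k 0. card (reflecting_walks N b d))"
  let ?A = "1 + real k * C + real (card (dyck_words k 0))"
  let ?L = "real k ^ k * real K ^ k"
  let ?s = "sqrt (2 * real b) ^ k"
  have pos: "real N > 0" "?s > 0" "c > 0" "sqrt c > 0"
    using assms(1,2) by (auto simp: c_def)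
  have deg: "real (card (degenerate_walks k)) \<le> ?L * sqrt c ^ k * real N * (1 / sqrt c)"
    using card_degenerate_walks_le[of k] pos by (simp add: c_def field_simps)
  have "real (card (crossing_walks k))
      \<le> real k ^ k * (real k * real K ^ k * sqrt c ^ k * (c * real D3 + real N * real D1)) / c\<^sup>2"
    using card_crossing_walks_le[OF D1 D3, of k] pos by (simp add: c_def pos_le_divide_eq mult.commute)
  also have "\<dots> = ?L * sqrt c ^ k * real N * (real k * (real D3 / (real N * c) + real D1 / c\<^sup>2))"
    using pos by (simp add: field_simps power2_eq_square)
  finally have cross: "real (card (crossing_walks k))
      \<le> ?L * sqrt c ^ k * real N * (real k * (real D3 / (real N * c) + real D1 / c\<^sup>2))" .
  have "\<bar>?S - ?G\<bar> \<le> ?A * real (card (degenerate_walks k) + card (crossing_walks k))"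
    by (rule abs_sum_expectation_diff_le[OF C])
  also have "\<dots> \<le> ?A * (?L * sqrt c ^ k * real N
      * (1 / sqrt c + real k * (real D3 / (real N * c) + real D1 / c\<^sup>2)))"
    using add_mono[OF deg cross] \<open>0 \<le> C\<close> by (intro mult_left_mono) (simp_all add: distrib_left)
  finally have "\<bar>?S - ?G\<bar> / (real N * ?s) \<le> ?A * (?L * sqrt c ^ k * real N
      * (1 / sqrt c + real k * (real D3 / (real N * c) + real D1 / c\<^sup>2))) / (real N * ?s)"
    using pos by (intro divide_right_mono) auto
  also have "\<dots> = ?A * ?L * ((sqrt c / sqrt (2 * real b)) ^ k
      * (1 / sqrt c + real k * (real D3 / (real N * c) + real D1 / c\<^sup>2)))"
    using pos by (simp add: power_divide)
  also have "\<bar>?S - ?G\<bar> / (real N * ?s) = \<bar>?S / ?s / real N - ?G / (real N * ?s)\<bar>"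
    using pos by (simp add: diff_divide_distrib[symmetric] abs_divide mult.commute)
  finally show ?thesis
    by (simp only: expectation_trace)
qed

text \<open>A Dyck word of length \<open>k\<close> has \<open>k / 2\<close> pushes, hence
  \<open>(2b+1)^(k/2)\<close> walks from each starting point, except possibly for
  \<open>2 * k * b\<close> points near the ends of \<open>{1..N}\<close>.\<close>

lemma reflecting_walks_bounds:
  fixes N b k :: nat
  assumes "N > 0" "b > 0"
  defines "r \<equiv> (sqrt (2 * real b + 1) / sqrt (2 * real b)) ^ k"
    and "g \<equiv> real (\<Sum>d\<in>dyck_words k 0. card (reflecting_walks N b d)) / (real N * sqrt (2 * real b) ^ k)"
  shows "g \<le> real (card (dyck_words k 0)) * r"
    and "real (card (dyck_words k 0)) * ((1 - 2 * real k * (real b / real N)) * r) \<le> g"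
proof -
  let ?c = "2 * real b + 1"
  let ?D = "dyck_words k 0"
  let ?s = "sqrt (2 * real b) ^ k"
  have pos: "real N > 0" "?s > 0"
    using assms(1,2) by auto
  have pow: "real ((2 * b + 1) ^ count_list d True) = sqrt ?c ^ k" if d: "d \<in> ?D" for d
  proof -
    have "k = 2 * count_list d True"
      using d dyck_length[of 0 d] by (simp add: dyck_words_def)
    then have "sqrt ?c ^ k = (sqrt ?c ^ 2) ^ count_list d True"
      by (metis power_mult)
    then show ?thesis
      by (simp add: add.commute)
  qed
  have "real (card (reflecting_walks N b d)) \<le> real N * sqrt ?c ^ k" if d: "d \<in> ?D" for d
    using card_reflecting_walks_le[of N b d] pow[OF d] by (metis of_nat_le_iff of_nat_mult)
  then have "(\<Sum>d\<in>?D. real (card (reflecting_walks N b d))) \<le> (\<Sum>d\<in>?D. real N * sqrt ?c ^ k)"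
    by (intro sum_mono)
  then have "g \<le> real (card ?D) * (real N * sqrt ?c ^ k) / (real N * ?s)"
    unfolding g_def using pos by (intro divide_right_mono) auto
  also have "\<dots> = real (card ?D) * r"
    using pos by (simp add: r_def power_divide)
  finally show "g \<le> real (card ?D) * r" .
  have "(real N - 2 * real k * real b) * sqrt ?c ^ k \<le> real (card (reflecting_walks N b d))"
    if d: "d \<in> ?D" for d
  proof -
    have "length d = k" "dyck 0 d"
      using d by (auto simp: dyck_words_def)
    then have "(N - 2 * (k * b)) * (2 * b + 1) ^ count_list d True \<le> card (reflecting_walks N b d)"
      using card_reflecting_walks_ge by metis
    then have "real (N - 2 * (k * b)) * sqrt ?c ^ k \<le> real (card (reflecting_walks N b d))"
      using pow[OF d] by (metis of_nat_le_iff of_nat_mult)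
    \<comment> \<open>If the margins exceed \<open>N\<close>, the left side is negative and the
      truncated difference is 0.\<close>
    moreover have "real N - 2 * real k * real b \<le> real (N - 2 * (k * b))"
    proof -
      have "real N - real (2 * (k * b)) \<le> real (N - 2 * (k * b))"
        by linarith
      then show ?thesis
        by simp
    qed
    ultimately show ?thesis
      by (elim order_trans[rotated]) (intro mult_right_mono, auto)
  qed
  then have "(\<Sum>d\<in>?D. (real N - 2 * real k * real b) * sqrt ?c ^ k)
      \<le> (\<Sum>d\<in>?D. real (card (reflecting_walks N b d)))"
    by (intro sum_mono)
  then have "real (card ?D) * ((real N - 2 * real k * real b) * sqrt ?c ^ k) / (real N * ?s) \<le> g"
    unfolding g_def using pos by (intro divide_right_mono) auto
  moreover have "real (card ?D) * ((real N - 2 * real k * real b) * sqrt ?c ^ k) / (real N * ?s)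
      = real (card ?D) * ((1 - 2 * real k * (real b / real N)) * r)"
    using pos by (simp add: r_def power_divide field_simps)
  ultimately show "real (card ?D) * ((1 - 2 * real k * (real b / real N)) * r) \<le> g"
    by simp
qed

theorem mainTheorem14:
  fixes b :: "nat \<Rightarrow> nat"
    and R :: "nat \<Rightarrow> ((nat \<times> nat) \<times> (nat \<times> nat)) set"
    and M :: "nat \<Rightarrow> 'a measure"
    and X :: "nat \<Rightarrow> nat \<Rightarrow> nat \<Rightarrow> 'a \<Rightarrow> real"
    and k :: nat
  assumes b_pos: "\<And>N. b N > 0"
    and b_inf: "filterlim b at_top at_top"
    and b_small: "(\<lambda>N. real (b N)) \<in> o(\<lambda>N. real N)"
    and R_equiv: "\<And>N. equiv ({1..N} \<times> {1..N}) (R N)"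
    and R_sym: "\<And>N p q. p \<in> {1..N} \<Longrightarrow> q \<in> {1..N} \<Longrightarrow> ((p, q), (q, p)) \<in> R N"
    and O1: "(\<lambda>N. real (Max ((\<lambda>p. card {(q, r, s). q \<in> {1..N} \<and> r \<in> {1..N} \<and> s \<in> {1..N}
                                   \<and> ((p, q), (r, s)) \<in> R N}) ` {1..N})))
             \<in> o(\<lambda>N. (real (b N))\<^sup>2)"
    and O2: "\<exists>B::nat. \<forall>N. \<forall>p\<in>{1..N}. \<forall>q\<in>{1..N}. \<forall>r\<in>{1..N}.
               card {s \<in> {1..N}. ((p, q), (r, s)) \<in> R N} \<le> B"
    and O3: "(\<lambda>N. real (card {(p, q, r). p \<in> {1..N} \<and> q \<in> {1..N} \<and> r \<in> {1..N}
                                   \<and> ((p, q), (q, r)) \<in> R N \<and> r \<noteq> p}))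
             \<in> o(\<lambda>N. (real (b N))\<^sup>2)"
    and prob: "\<And>N. prob_space (M N)"
    and meas: "\<And>N i j. i \<in> {1..N} \<Longrightarrow> j \<in> {1..N} \<Longrightarrow> X N i j \<in> borel_measurable (M N)"
    and X_sym: "\<And>N i j. i \<in> {1..N} \<Longrightarrow> j \<in> {1..N} \<Longrightarrow> X N i j = X N j i"
    and X_mean: "\<And>N i j. i \<in> {1..N} \<Longrightarrow> j \<in> {1..N} \<Longrightarrow>
                   prob_space.expectation (M N) (X N i j) = 0"
    and X_var: "\<And>N i j. i \<in> {1..N} \<Longrightarrow> j \<in> {1..N} \<Longrightarrow>
                   prob_space.expectation (M N) (\<lambda>\<omega>. (X N i j \<omega>)\<^sup>2) = 1"
    and X_int: "\<And>N i j m. i \<in> {1..N} \<Longrightarrow> j \<in> {1..N} \<Longrightarrow>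
                   integrable (M N) (\<lambda>\<omega>. \<bar>X N i j \<omega>\<bar> ^ m)"
    and X_moments: "\<And>m. \<exists>C. \<forall>N. \<forall>i\<in>{1..N}. \<forall>j\<in>{1..N}.
                   prob_space.expectation (M N) (\<lambda>\<omega>. \<bar>X N i j \<omega>\<bar> ^ m) \<le> C"
    and X_indep: "\<And>N. prob_space.indep_vars (M N) (\<lambda>C. PiM C (\<lambda>_. borel))
                   (\<lambda>C \<omega>. restrict (\<lambda>(p, q). X N p q \<omega>) C)
                   (({1..N} \<times> {1..N}) // R N)"
  shows "(\<lambda>N. prob_space.expectation (M N)
                 (\<lambda>\<omega>. sqmat_trace N (sqmat_pow N (band_matrix (b N) (\<lambda>i j. X N i j \<omega>)) k))
               / real N)
         \<longlonglongrightarrow> (if even k then catalan (k div 2) else 0)"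
proof -
  obtain B :: nat where B: "\<forall>N. \<forall>p\<in>{1..N}. \<forall>q\<in>{1..N}. \<forall>r\<in>{1..N}.
      card {s \<in> {1..N}. ((p, q), (r, s)) \<in> R N} \<le> B"
    using O2 by blast
  \<comment> \<open>The maximum secures \<open>1 \<le> K\<close>; in the same way \<open>C\<close>
    below is made nonnegative.\<close>
  define K where "K = max 1 B"
  obtain C0 where C0: "\<forall>N. \<forall>i\<in>{1..N}. \<forall>j\<in>{1..N}.
      prob_space.expectation (M N) (\<lambda>\<omega>. \<bar>X N i j \<omega>\<bar> ^ k) \<le> C0"
    using X_moments by blast
  define C where "C = max 0 C0"
  define T where "T N p = card {(q, r, s). q \<in> {1..N} \<and> r \<in> {1..N} \<and> s \<in> {1..N}
                                   \<and> ((p, q), (r, s)) \<in> R N}" for N p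
  define D1 where "D1 N = Max (T N ` {1..N})" for N
  define D3 where "D3 N = card {(p, q, r). p \<in> {1..N} \<and> q \<in> {1..N} \<and> r \<in> {1..N}
                                   \<and> ((p, q), (q, r)) \<in> R N \<and> r \<noteq> p}" for N
  have ens: "band_ensemble N K (R N) (M N) (X N)" for N
  proof -
    interpret prob_space "M N"
      by (rule prob)
    show ?thesis
    proof
      show "card {s \<in> {1..N}. ((p, q), (r, s)) \<in> R N} \<le> K"
        if "p \<in> {1..N}" "q \<in> {1..N}" "r \<in> {1..N}" for p q r
        using B that unfolding K_def by (meson le_max_iff_disj)
    qed (use R_equiv R_sym meas X_sym X_mean X_var X_int X_indep in \<open>auto simp: K_def\<close>)
  qed
  let ?n = "real (card (dyck_words k 0))"
  let ?A = "(1 + real k * C + ?n) * (real k ^ k * real K ^ k)"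
  let ?c = "\<lambda>N. 2 * real (b N) + 1"
  let ?r = "\<lambda>N. (sqrt (?c N) / sqrt (2 * real (b N))) ^ k"
  let ?f = "\<lambda>N. prob_space.expectation (M N)
                 (\<lambda>\<omega>. sqmat_trace N (sqmat_pow N (band_matrix (b N) (\<lambda>i j. X N i j \<omega>)) k)) / real N"
  let ?g = "\<lambda>N. real (\<Sum>d\<in>dyck_words k 0. card (reflecting_walks N (b N) d))
                 / (real N * sqrt (2 * real (b N)) ^ k)"
  let ?h = "\<lambda>N. ?A * (?r N * (1 / sqrt (?c N) + real k * (real (D3 N) / (real N * ?c N)
                 + real (D1 N) / (?c N)\<^sup>2)))"
  have b_real: "filterlim (\<lambda>N. real (b N)) at_top at_top"
    by (rule filterlim_compose[OF filterlim_real_sequentially b_inf])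
  have bN: "(\<lambda>N. real (b N) / real N) \<longlonglongrightarrow> 0"
    by (rule smalloD_tendsto[OF b_small])
  have diff: "\<bar>?f N - ?g N\<bar> \<le> ?h N" if "N > 0" for N
  proof (rule band_ensemble.abs_trace_diff_le[OF ens that b_pos])
    show "prob_space.expectation (M N) (\<lambda>\<omega>. \<bar>X N i j \<omega>\<bar> ^ k) \<le> C" if "i \<in> {1..N}" "j \<in> {1..N}" for i j
      using C0 that unfolding C_def by (meson le_max_iff_disj)
    show "card {(q, r, s). q \<in> {1..N} \<and> r \<in> {1..N} \<and> s \<in> {1..N} \<and> ((p, q), (r, s)) \<in> R N} \<le> D1 N"
      if "p \<in> {1..N}" for p
      unfolding D1_def T_def[symmetric] using that by (intro Max_ge) auto
  qed (simp_all add: C_def D3_def)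
  have r: "?r \<longlonglongrightarrow> 1"
  proof -
    have "((\<lambda>x. sqrt (2 * x + 1) / sqrt (2 * x)) \<longlongrightarrow> 1) at_top"
      by real_asymp
    from tendsto_power[OF filterlim_compose[OF this b_real], of k] show ?thesis
      by simp
  qed
  have c1: "(\<lambda>N. 1 / sqrt (?c N)) \<longlonglongrightarrow> 0"
  proof -
    have "((\<lambda>x::real. 1 / sqrt (2 * x + 1)) \<longlongrightarrow> 0) at_top"
      by real_asymp
    from filterlim_compose[OF this b_real] show ?thesis .
  qed
  have c2: "(\<lambda>N. real (D1 N) / (?c N)\<^sup>2) \<longlonglongrightarrow> 0"
  proof (rule tendsto_sandwich[OF _ _ tendsto_const])
    show "(\<lambda>N. real (D1 N) / (real (b N))\<^sup>2) \<longlonglongrightarrow> 0"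
      using smalloD_tendsto[OF O1] unfolding D1_def T_def .
    show "\<forall>\<^sub>F N in sequentially. real (D1 N) / (?c N)\<^sup>2 \<le> real (D1 N) / (real (b N))\<^sup>2"
      using b_pos by (intro always_eventually allI divide_left_mono power_mono mult_pos_pos) auto
  qed auto
  \<comment> \<open>As \<open>b\<close> is \<open>o(N)\<close>, eventually the square of
    \<open>b N\<close> is at most \<open>N * (2 * b N + 1)\<close>, so (O3) controls the
    quotient.\<close>
  have c3: "(\<lambda>N. real (D3 N) / (real N * ?c N)) \<longlonglongrightarrow> 0"
  proof (rule tendsto_sandwich[OF _ _ tendsto_const])
    show "(\<lambda>N. real (D3 N) / (real (b N))\<^sup>2) \<longlonglongrightarrow> 0"
      using smalloD_tendsto[OF O3] unfolding D3_def .
    have "\<forall>\<^sub>F N in sequentially. real (b N) / real N < 1"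
      using order_tendstoD(2)[OF bN] by simp
    then show "\<forall>\<^sub>F N in sequentially. real (D3 N) / (real N * ?c N) \<le> real (D3 N) / (real (b N))\<^sup>2"
      using eventually_gt_at_top[of 0]
    proof eventually_elim
      case (elim N)
      then have "real (b N) \<le> real N"
        by (simp add: divide_simps)
      then have "real (b N) * real (b N) \<le> real N * ?c N"
        by (intro mult_mono) auto
      then show ?case
        using b_pos[of N] elim unfolding power2_eq_square
        by (intro divide_left_mono mult_pos_pos) auto
    qed
  qed auto
  have "?h \<longlonglongrightarrow> ?A * (1 * (0 + real k * (0 + 0)))"
    by (intro tendsto_mult tendsto_add tendsto_const r c1 c2 c3)
  then have h: "?h \<longlonglongrightarrow> 0"
    by simp
  have "(\<lambda>N. ?f N - ?g N) \<longlonglongrightarrow> 0"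
    by (rule Lim_null_comparison[OF _ h])
      (use diff in \<open>auto intro: eventually_mono[OF eventually_gt_at_top[of 0]]\<close>)
  moreover have "?g \<longlonglongrightarrow> ?n"
  proof (rule tendsto_sandwich)
    show "\<forall>\<^sub>F N in sequentially. ?g N \<le> ?n * ?r N"
      using eventually_gt_at_top[of 0] by eventually_elim (rule reflecting_walks_bounds(1)[OF _ b_pos])
    show "\<forall>\<^sub>F N in sequentially. ?n * ((1 - 2 * real k * (real (b N) / real N)) * ?r N) \<le> ?g N"
      using eventually_gt_at_top[of 0] by eventually_elim (rule reflecting_walks_bounds(2)[OF _ b_pos])
    show "(\<lambda>N. ?n * ?r N) \<longlonglongrightarrow> ?n"
      using tendsto_mult[OF tendsto_const r, of ?n] by simp
    have "(\<lambda>N. ?n * ((1 - 2 * real k * (real (b N) / real N)) * ?r N))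
        \<longlonglongrightarrow> ?n * ((1 - 2 * real k * 0) * 1)"
      by (intro tendsto_mult tendsto_diff tendsto_const r bN)
    then show "(\<lambda>N. ?n * ((1 - 2 * real k * (real (b N) / real N)) * ?r N)) \<longlonglongrightarrow> ?n"
      by simp
  qed
  ultimately have "?f \<longlonglongrightarrow> ?n"
    using tendsto_add[of "\<lambda>N. ?f N - ?g N" 0 sequentially ?g ?n] by simp
  \<comment> \<open>For odd \<open>k\<close> there are no Dyck words, which gives the limit
    0.\<close>
  moreover have "?n = (if even k then catalan (k div 2) else 0)"
    using card_dyck_words_catalan[of "k div 2"] dyck_words_odd[of k] by auto
  ultimately show ?thesis
    by simp
qed

end
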